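(* Let $\mathbb{CP}^1$ be equipped with the Fubini-Study metric and let the line bundle $O_{\mathbb{CP}^1}(a)$ carry the induced Fubini-Study metric. Then for every integer $a\geq 0$ the Ray-Singer analytic torsion is $$T(\mathbb{CP}^1,O_{\mathbb{CP}^1}(a))=\tfrac12(a+1)^2+\log\left(\prod_{i=0}^{a}\frac{i!\,(a-i)!}{(a+1)!}\right)-4\zeta'(-1),$$ where $\zeta$ is the Riemann zeta function.
   Context: Conventions: in the coordinate $z=x_1/x_0$ the Fubini-Study metric on $\mathbb{CP}^1$ is $\|\partial_z\|^2=(1+|z|^2)^{-2}$, with normalized Kähler form $\omega=\frac{\mathrm i}{2\pi}\frac{dz\wedge d\bar z}{(1+|z|^2)^2}$, and the metric on $O_{\mathbb{CP}^1}(a)$ satisfies $\|x_0^a\|^2=(1+|z|^2)^{-a}$. For a Hermitian holomorphic bundle $E$ on $\mathbb{CP}^1$, the Ray-Singer analytic torsion is $T(\mathbb{CP}^1,E)=T(E)=\sum_{q\geq0}(-1)^q q\,\zeta_q'(0)$ (note the sign convention), where $\zeta_q(s)=\sum_{\lambda}\lambda^{-s}$, analytically continued to $s=0$, the sum running over the nonzero eigenvalues (with multiplicity) of the Laplacian $\bar\partial\bar\partial^*+\bar\partial^*\bar\partial$ on smooth $E$-valued $(0,q)$-forms, adjoints being taken for the $L^2$ inner products given by integrating the pointwise inner products against $\omega$. *)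

theory Defs
  imports "HOL-Complex_Analysis.Complex_Analysis" "HOL-Library.Function_Algebras"
begin

text \<open>
  Let \<open>z = x\<^sub>1/x\<^sub>0\<close> and \<open>w = x\<^sub>0/x\<^sub>1 = 1/z\<close> be the two standard affine coordinates on
  the complex projective line.  A smooth \<open>O(a)\<close>-valued form of type \<open>(0,q)\<close> is encoded by its
  coefficient in the \<open>z\<close>-chart, with respect to the frame \<open>x\<^sub>0\<^sup>a\<close> (for \<open>q = 0\<close>)
  or \<open>d(cnj z) \<otimes> x\<^sub>0\<^sup>a\<close> (for \<open>q = 1\<close>).  This determines the form, since the
  \<open>z\<close>-chart is dense; the form is smooth on the whole line iff the coefficient is smooth and so is
  the coefficient in the \<open>w\<close>-chart.
\<close>

definition partial_deriv :: "complex \<Rightarrow> (complex \<Rightarrow> complex) \<Rightarrow> complex \<Rightarrow> complex" where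
  "partial_deriv v f = (\<lambda>z. frechet_derivative f (at z) v)"

primrec C_diff :: "nat \<Rightarrow> (complex \<Rightarrow> complex) \<Rightarrow> bool" where
  "C_diff 0 f \<longleftrightarrow> continuous_on UNIV f"
| "C_diff (Suc k) f \<longleftrightarrow> (\<forall>z. f differentiable (at z)) \<and>
     C_diff k (partial_deriv 1 f) \<and> C_diff k (partial_deriv \<i> f)"

text \<open>Smoothness in the real sense, i.e. as functions of the real and imaginary part.\<close>

definition smooth :: "(complex \<Rightarrow> complex) \<Rightarrow> bool" where
  "smooth f \<longleftrightarrow> (\<forall>k. C_diff k f)"

text \<open>
  The gluing conditions come from \<open>x\<^sub>1\<^sup>a = z\<^sup>a x\<^sub>0\<^sup>a\<close> and
  \<open>d(cnj w) = - (cnj z)\<^sup>-\<^sup>2 d(cnj z)\<close>; \<open>g\<close> is the coefficient in the \<open>w\<close>-chart.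
\<close>

definition forms :: "nat \<Rightarrow> nat \<Rightarrow> (complex \<Rightarrow> complex) set" where
  "forms a q =
     (if q = 0 then
        {f. smooth f \<and> (\<exists>g. smooth g \<and> (\<forall>z. z \<noteq> 0 \<longrightarrow> f z = z ^ a * g (1 / z)))}
      else if q = 1 then
        {f. smooth f \<and> (\<exists>g. smooth g \<and> (\<forall>z. z \<noteq> 0 \<longrightarrow> f z = - (z ^ a / cnj z ^ 2) * g (1 / z)))}
      else {0})"

text \<open>
  The pointwise inner product on forms of type \<open>(0,q)\<close> has weight
  \<open>(1+|z|\<^sup>2)\<^sup>-\<^sup>a (1+|z|\<^sup>2)\<^sup>2\<^sup>q\<close>, because \<open>d(cnj z)\<close> has square norm
  \<open>(1+|z|\<^sup>2)\<^sup>2\<close>, dual to that of \<open>\<partial>\<^sub>z\<close>.  As \<open>(\<i>/2) dz \<and> d(cnj z)\<close> is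
  Lebesgue measure, the normalized Kaehler form has density \<open>1 / (\<pi> (1+|z|\<^sup>2)\<^sup>2)\<close>.
  The point at infinity is a null set.
\<close>

definition fs_metric :: "nat \<Rightarrow> nat \<Rightarrow> complex \<Rightarrow> real" where
  "fs_metric a q z = (1 + (cmod z)\<^sup>2) ^ (2 * q) / (1 + (cmod z)\<^sup>2) ^ a"

definition fs_volume :: "complex \<Rightarrow> real" where
  "fs_volume z = 1 / (pi * (1 + (cmod z)\<^sup>2)\<^sup>2)"

definition l2_inner :: "nat \<Rightarrow> nat \<Rightarrow> (complex \<Rightarrow> complex) \<Rightarrow> (complex \<Rightarrow> complex) \<Rightarrow> complex" where
  "l2_inner a q f g =
     (LINT z|lborel. f z * cnj (g z) * of_real (fs_metric a q z) * of_real (fs_volume z))"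

text \<open>The operator from \<open>(0,q)\<close>-forms to \<open>(0,q+1)\<close>-forms, and its formal adjoint.\<close>

definition dbar :: "nat \<Rightarrow> (complex \<Rightarrow> complex) \<Rightarrow> complex \<Rightarrow> complex" where
  "dbar q f = (if q = 0 then (\<lambda>z. (partial_deriv 1 f z + \<i> * partial_deriv \<i> f z) / 2) else 0)"

definition dbar_adj :: "nat \<Rightarrow> nat \<Rightarrow> (complex \<Rightarrow> complex) \<Rightarrow> complex \<Rightarrow> complex" where
  "dbar_adj a q f = (THE u. u \<in> forms a q \<and>
     (\<forall>v\<in>forms a q. l2_inner a (Suc q) (dbar q v) f = l2_inner a q v u))"

definition laplacian :: "nat \<Rightarrow> nat \<Rightarrow> (complex \<Rightarrow> complex) \<Rightarrow> complex \<Rightarrow> complex" where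
  "laplacian a q f =
     (case q of 0 \<Rightarrow> 0 | Suc p \<Rightarrow> dbar p (dbar_adj a p f)) + dbar_adj a q (dbar q f)"

definition fun_scale :: "complex \<Rightarrow> (complex \<Rightarrow> complex) \<Rightarrow> complex \<Rightarrow> complex" where
  "fun_scale c f = (\<lambda>z. c * f z)"

global_interpretation cfun: vector_space fun_scale
  by unfold_locales (auto simp: fun_scale_def fun_eq_iff algebra_simps)

definition eigenspace :: "nat \<Rightarrow> nat \<Rightarrow> complex \<Rightarrow> (complex \<Rightarrow> complex) set" where
  "eigenspace a q \<mu> = {f \<in> forms a q. laplacian a q f = fun_scale \<mu> f}"

definition nonzero_eigenvalues :: "nat \<Rightarrow> nat \<Rightarrow> complex set" where
  "nonzero_eigenvalues a q = {\<mu>. \<mu> \<noteq> 0 \<and> (\<exists>f\<in>eigenspace a q \<mu>. f \<noteq> 0)}"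

text \<open>
  The value at \<open>s\<close> of the analytic continuation of a series \<open>\<Sum>\<^sub>i F i\<close> that converges
  (absolutely) on some right half-plane: \<open>Z\<close> is a meromorphic continuation to a right half-plane
  containing \<open>s\<close>.  Meromorphic functions may have arbitrary values at isolated points here, hence
  the requirement that \<open>Z\<close> be analytic at \<open>s\<close>.
\<close>

definition continuation :: "('i \<Rightarrow> complex \<Rightarrow> complex) \<Rightarrow> 'i set \<Rightarrow> complex \<Rightarrow> complex" where
  "continuation F I s = (THE w. \<exists>Z b c.
     b < Re s \<and> Z meromorphic_on {t. b < Re t} \<and>
     (\<forall>t. c < Re t \<longrightarrow> ((\<lambda>i. F i t) has_sum Z t) I) \<and>
     Z analytic_on {s} \<and> w = Z s)"

definition spectral_zeta :: "nat \<Rightarrow> nat \<Rightarrow> complex \<Rightarrow> complex" where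
  "spectral_zeta a q =
     continuation (\<lambda>\<mu> s. of_nat (cfun.dim (eigenspace a q \<mu>)) * \<mu> powr (- s)) (nonzero_eigenvalues a q)"

definition riemann_zeta :: "complex \<Rightarrow> complex" where
  "riemann_zeta = continuation (\<lambda>n s. of_nat n powr (- s)) {n::nat. 1 \<le> n}"

text \<open>There are no forms of type \<open>(0,q)\<close> with \<open>q > 1\<close> on a curve.\<close>

definition analytic_torsion :: "nat \<Rightarrow> complex" where
  "analytic_torsion a = (\<Sum>q\<le>1. (- 1) ^ q * of_nat q * deriv (spectral_zeta a q) 0)"

end

theory Submission
  imports Defs
begin

text \<open>
  With \<open>\<rho> = 1 + |z|\<^sup>2\<close>, multiplication by \<open>\<rho>\<^sup>2\<close> identifies \<open>(0,1)\<close>-forms with values in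
  \<open>O(b)\<close> isometrically with sections of \<open>O(b+2)\<close>.  The Cauchy-Riemann operator becomes
  \<open>D : O(b) \<rightarrow> O(b+2)\<close> with adjoint \<open>A\<close>, and the curvature of the Fubini-Study metric gives
  \<open>D A = A D + (b + 2)\<close>.  Hence \<open>D\<close> identifies the \<open>\<nu>\<close>-eigenspace of \<open>A D\<close> on \<open>O(b)\<close>, \<open>\<nu> \<noteq> 0\<close>,
  with the \<open>(\<nu> - b - 2)\<close>-eigenspace on \<open>O(b+2)\<close>.  As \<open>A D \<ge> 0\<close>, iterating \<open>D\<close> must end in the
  kernel, i.e. in polynomials of degree at most \<open>b + 2n\<close>.  So on \<open>(0,1)\<close>-forms the spectrum is
  \<open>n(n + m)\<close> with multiplicity \<open>2n + m\<close>, where \<open>m = a + 1\<close> and \<open>n \<ge> 1\<close>.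

  Writing \<open>u = n\<^sup>-\<^sup>s\<close>, \<open>v = (n + m)\<^sup>-\<^sup>s\<close>, the spectral zeta function is compared with
  \<open>\<Sum> (n u\<^sup>2 + (n + m) v\<^sup>2) + (m/2) (1 - s) \<Sum> (u\<^sup>2 - v\<^sup>2)\<close>, whose first sum is \<open>2 \<zeta>(2s - 1)\<close> up to
  finitely many terms and whose second sum telescopes.  The remaining series converges for
  \<open>Re s > -1/2\<close> and vanishes to second order at \<open>0\<close>, so it does not contribute to the derivative.
\<close>

section \<open>Smooth functions and Wirtinger derivatives\<close>

text \<open>The formal adjoint is a definite description over smooth forms, so it has to be
  computed: existence is Stokes' theorem on the projective line, uniqueness the definiteness of the
  inner product. Behaviour near infinity is always read off in the w-chart.

  The compensating series comes from (2n+m) u v - n u^2 - (n+m) v^2 = (m/2)(u^2 - v^2) -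
  (2n+m)(u-v)^2/2. The last term has size s^2 n^(-1-2s), so its sum reaches only Re s > 0. To
  leading order (2n+m)(u-v) is s m (u+v), which makes that term (m/2) s (u^2 - v^2) plus a smaller
  remainder; hence the coefficient 1 - s. Differentiating 1 - s at 0, where the telescoped sum has
  the value m, produces -m^2/2, the source of the quadratic term of the torsion.

  Since 2s - 1 is near -1, the Riemann zeta function is needed around -1. The plain trapezoidal rule
  continues it to Re s > -1 only, so one Euler-Maclaurin correction is included, which reaches Re s
  > -3.\<close>

definition has_wirt :: "(complex \<Rightarrow> complex) \<Rightarrow> complex \<Rightarrow> complex \<Rightarrow> complex \<Rightarrow> bool" where
  "has_wirt f p q z \<longleftrightarrow> (f has_derivative (\<lambda>h. p * h + q * cnj h)) (at z)"

definition dz :: "(complex \<Rightarrow> complex) \<Rightarrow> complex \<Rightarrow> complex" where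
  "dz f = (\<lambda>z. (partial_deriv 1 f z - \<i> * partial_deriv \<i> f z) / 2)"

lemma partial_deriv_eqI: "(f has_derivative f') (at z) \<Longrightarrow> partial_deriv v f z = f' v"
  unfolding partial_deriv_def by (metis frechet_derivative_at)

lemma has_wirt_partial: "has_wirt f p q z \<Longrightarrow> partial_deriv v f z = p * v + q * cnj v"
  unfolding has_wirt_def by (rule partial_deriv_eqI)

lemma has_wirt_dz: "has_wirt f p q z \<Longrightarrow> dz f z = p"
  by (simp add: dz_def has_wirt_partial algebra_simps)

lemma has_wirt_dbar: "has_wirt f p q z \<Longrightarrow> dbar 0 f z = q"
  by (simp add: dbar_def has_wirt_partial algebra_simps)

text \<open>A real-linear map of the plane is determined by its values at 1 and \<open>\<i>\<close>,
  and \<open>p * h + q * cnj h\<close> fits any two such values. Carrying both coefficients through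
  every rule keeps the calculus symmetric under conjugation, which swaps and conjugates
  them.\<close>

lemma has_wirt_differentiable: "f differentiable (at z) \<Longrightarrow> has_wirt f (dz f z) (dbar 0 f z) z"
proof -
  assume "f differentiable (at z)"
  then have L: "(f has_derivative frechet_derivative f (at z)) (at z)"
    by (simp add: frechet_derivative_works)
  interpret L: linear "frechet_derivative f (at z)"
    using L has_derivative_linear by blast
  have "frechet_derivative f (at z) = (\<lambda>h. dz f z * h + dbar 0 f z * cnj h)"
  proof
    fix h
    define x y where "x = Re h" and "y = Im h"
    have h: "h = x *\<^sub>R 1 + y *\<^sub>R \<i>"
      by (simp add: complex_eq_iff x_def y_def)
    have "frechet_derivative f (at z) h = x *\<^sub>R partial_deriv 1 f z + y *\<^sub>R partial_deriv \<i> f z"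
      by (simp only: h L.add L.scaleR partial_deriv_def)
    also have "\<dots> = dz f z * h + dbar 0 f z * cnj h"
      by (simp add: h dz_def dbar_def scaleR_conv_of_real field_simps)
    finally show "frechet_derivative f (at z) h = dz f z * h + dbar 0 f z * cnj h" .
  qed
  with L show ?thesis by (simp add: has_wirt_def)
qed

lemma has_wirt_cong_open:
  assumes "has_wirt f p q z" "open S" "z \<in> S" "\<And>x. x \<in> S \<Longrightarrow> f x = g x"
  shows "has_wirt g p q z"
  using assms(1) unfolding has_wirt_def
  by (rule has_derivative_transform_within_open[OF _ assms(2,3)]) (rule assms(4))

lemma has_wirt_const: "has_wirt (\<lambda>_. c) 0 0 z"
  by (simp add: has_wirt_def)

lemma has_wirt_field: "(f has_field_derivative p) (at z) \<Longrightarrow> has_wirt f p 0 z"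
  by (simp add: has_wirt_def has_field_derivative_def)

lemma has_wirt_add:
  "has_wirt f p q z \<Longrightarrow> has_wirt g r s z \<Longrightarrow> has_wirt (\<lambda>z. f z + g z) (p + r) (q + s) z"
  unfolding has_wirt_def
  by (drule (1) has_derivative_add) (simp add: algebra_simps)

lemma has_wirt_diff:
  "has_wirt f p q z \<Longrightarrow> has_wirt g r s z \<Longrightarrow> has_wirt (\<lambda>z. f z - g z) (p - r) (q - s) z"
  unfolding has_wirt_def
  by (drule (1) has_derivative_diff) (simp add: algebra_simps)

lemma has_wirt_mult:
  "has_wirt f p q z \<Longrightarrow> has_wirt g r s z \<Longrightarrow>
    has_wirt (\<lambda>z. f z * g z) (p * g z + f z * r) (q * g z + f z * s) z"
  unfolding has_wirt_def
  by (drule (1) has_derivative_mult) (simp add: algebra_simps)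

lemma has_wirt_cnj: "has_wirt f p q z \<Longrightarrow> has_wirt (\<lambda>z. cnj (f z)) (cnj q) (cnj p) z"
  unfolding has_wirt_def
  by (drule has_derivative_cnj) (simp add: algebra_simps)

lemma has_wirt_compose_field:
  assumes "has_wirt f p q (g z)" "(g has_field_derivative d) (at z)"
  shows "has_wirt (\<lambda>z. f (g z)) (p * d) (q * cnj d) z"
  using has_derivative_compose[OF assms(2)[unfolded has_field_derivative_def] assms(1)[unfolded has_wirt_def]]
  by (simp add: has_wirt_def algebra_simps)

lemma has_wirt_field_compose:
  assumes "has_wirt f p q z" "(g has_field_derivative d) (at (f z))"
  shows "has_wirt (\<lambda>z. g (f z)) (d * p) (d * q) z"
  using has_derivative_compose[OF assms(1)[unfolded has_wirt_def] assms(2)[unfolded has_field_derivative_def]]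
  by (simp add: has_wirt_def algebra_simps)

text \<open>The product and inverse rules leave factors undifferentiated, so their induction steps
  need the given functions one order lower.\<close>

lemma C_diff_SucD: "C_diff (Suc k) f \<Longrightarrow> C_diff k f"
proof (induction k arbitrary: f)
  case 0
  then show ?case
    by (auto intro!: continuous_at_imp_continuous_on differentiable_imp_continuous_within)
next
  case (Suc k)
  from Suc.prems show ?case
    unfolding C_diff.simps(2)[of "Suc k"] C_diff.simps(2)[of k f] using Suc.IH by blast
qed

lemma C_diff_const: "C_diff k (\<lambda>_. c)"
  by (induction k arbitrary: c) (simp_all add: partial_deriv_def)

lemma partial_deriv_id: "partial_deriv v (\<lambda>z. z) = (\<lambda>_. v)"
  by (rule ext, rule partial_deriv_eqI) (rule has_derivative_ident)

lemma C_diff_id: "C_diff k (\<lambda>z. z)"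
  by (cases k) (simp_all add: partial_deriv_id C_diff_const)

lemma C_diff_cnj: "C_diff k f \<Longrightarrow> C_diff k (\<lambda>z. cnj (f z))"
proof (induction k arbitrary: f)
  case 0
  then show ?case by (simp add: continuous_on_cnj)
next
  case (Suc k)
  have d: "((\<lambda>z. cnj (f z)) has_derivative (\<lambda>h. cnj (frechet_derivative f (at z) h))) (at z)" for z
    using Suc.prems by (auto intro!: has_derivative_cnj simp: frechet_derivative_works)
  have "partial_deriv v (\<lambda>z. cnj (f z)) = (\<lambda>z. cnj (partial_deriv v f z))" for v
    by (rule ext, subst partial_deriv_eqI[OF d]) (simp add: partial_deriv_def)
  moreover have "(\<lambda>z. cnj (f z)) differentiable (at z)" for z
    using d by (auto simp: differentiable_def)
  ultimately show ?case using Suc by auto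
qed

lemma C_diff_add: "C_diff k f \<Longrightarrow> C_diff k g \<Longrightarrow> C_diff k (\<lambda>z. f z + g z)"
proof (induction k arbitrary: f g)
  case 0
  then show ?case by (simp add: continuous_on_add)
next
  case (Suc k)
  have d: "((\<lambda>z. f z + g z) has_derivative
      (\<lambda>h. frechet_derivative f (at z) h + frechet_derivative g (at z) h)) (at z)" for z
    using Suc.prems by (auto intro!: has_derivative_add simp: frechet_derivative_works)
  have "partial_deriv v (\<lambda>z. f z + g z) = (\<lambda>z. partial_deriv v f z + partial_deriv v g z)" for v
    by (rule ext, subst partial_deriv_eqI[OF d]) (simp add: partial_deriv_def)
  moreover have "(\<lambda>z. f z + g z) differentiable (at z)" for z
    using d by (auto simp: differentiable_def)
  ultimately show ?case using Suc by auto
qed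

lemma C_diff_mult: "C_diff k f \<Longrightarrow> C_diff k g \<Longrightarrow> C_diff k (\<lambda>z. f z * g z)"
proof (induction k arbitrary: f g)
  case 0
  then show ?case by (simp add: continuous_on_mult)
next
  case (Suc k)
  have d: "((\<lambda>z. f z * g z) has_derivative
      (\<lambda>h. f z * frechet_derivative g (at z) h + frechet_derivative f (at z) h * g z)) (at z)" for z
    using Suc.prems by (auto intro!: has_derivative_mult simp: frechet_derivative_works)
  have "partial_deriv v (\<lambda>z. f z * g z) = (\<lambda>z. f z * partial_deriv v g z + partial_deriv v f z * g z)" for v
    by (rule ext, subst partial_deriv_eqI[OF d]) (simp add: partial_deriv_def)
  moreover have "(\<lambda>z. f z * g z) differentiable (at z)" for z
    using d by (auto simp: differentiable_def)
  ultimately show ?case using Suc C_diff_SucD[OF Suc.prems(1)] C_diff_SucD[OF Suc.prems(2)]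
    by (auto intro!: C_diff_add)
qed

lemma C_diff_minus: "C_diff k f \<Longrightarrow> C_diff k (\<lambda>z. - f z)"
  using C_diff_mult[OF C_diff_const[of k "- 1"], of f] by simp

lemma C_diff_inverse:
  assumes "\<And>z. f z \<noteq> 0"
  shows "C_diff k f \<Longrightarrow> C_diff k (\<lambda>z. inverse (f z))"
proof (induction k)
  case 0
  then show ?case by (simp add: continuous_on_inverse assms)
next
  case (Suc k)
  have d: "((\<lambda>z. inverse (f z)) has_derivative
      (\<lambda>h. - (inverse (f z) * frechet_derivative f (at z) h * inverse (f z)))) (at z)" for z
    using Suc.prems assms by (auto intro!: has_derivative_inverse simp: frechet_derivative_works)
  have "partial_deriv v (\<lambda>z. inverse (f z)) =
      (\<lambda>z. - (inverse (f z) * partial_deriv v f z * inverse (f z)))" for v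
    by (rule ext, subst partial_deriv_eqI[OF d]) (simp add: partial_deriv_def)
  moreover have "(\<lambda>z. inverse (f z)) differentiable (at z)" for z
    using d by (auto simp: differentiable_def)
  moreover note Suc.IH[OF C_diff_SucD[OF Suc.prems]]
  ultimately show ?case using Suc.prems
    by (auto intro!: C_diff_mult C_diff_minus)
qed

lemma smooth_const [intro]: "smooth (\<lambda>_. c)"
  by (simp add: smooth_def C_diff_const)

lemma smooth_id [intro]: "smooth (\<lambda>z. z)"
  by (simp add: smooth_def C_diff_id)

lemma smooth_cnj [intro]: "smooth f \<Longrightarrow> smooth (\<lambda>z. cnj (f z))"
  by (simp add: smooth_def C_diff_cnj)

lemma smooth_add [intro]: "smooth f \<Longrightarrow> smooth g \<Longrightarrow> smooth (\<lambda>z. f z + g z)"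
  by (simp add: smooth_def C_diff_add)

lemma smooth_mult [intro]: "smooth f \<Longrightarrow> smooth g \<Longrightarrow> smooth (\<lambda>z. f z * g z)"
  by (simp add: smooth_def C_diff_mult)

lemma smooth_minus [intro]: "smooth f \<Longrightarrow> smooth (\<lambda>z. - f z)"
  using smooth_mult[OF smooth_const[of "- 1"], of f] by simp

lemma smooth_diff [intro]: "smooth f \<Longrightarrow> smooth g \<Longrightarrow> smooth (\<lambda>z. f z - g z)"
  using smooth_add[of f "\<lambda>z. - g z"] by auto

lemma smooth_power [intro]: "smooth f \<Longrightarrow> smooth (\<lambda>z. f z ^ n)"
  by (induction n) auto

lemma smooth_divide [intro]:
  "smooth f \<Longrightarrow> smooth g \<Longrightarrow> (\<And>z. g z \<noteq> 0) \<Longrightarrow> smooth (\<lambda>z. f z / g z)"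
  unfolding divide_inverse by (rule smooth_mult) (auto simp: smooth_def C_diff_inverse)

lemma smooth_partial_deriv:
  assumes "smooth f"
  shows "smooth (partial_deriv 1 f)" "smooth (partial_deriv \<i> f)"
  using assms unfolding smooth_def by (metis C_diff.simps(2))+

lemma smooth_dz [intro]: "smooth f \<Longrightarrow> smooth (dz f)"
  unfolding dz_def by (intro smooth_divide smooth_diff smooth_mult smooth_const smooth_partial_deriv) auto

lemma smooth_dbar [intro]: "smooth f \<Longrightarrow> smooth (dbar 0 f)"
  unfolding dbar_def if_P[OF refl]
  by (intro smooth_divide smooth_add smooth_mult smooth_const smooth_partial_deriv) auto

lemma smooth_differentiable: "smooth f \<Longrightarrow> f differentiable (at z)"
  unfolding smooth_def by (metis C_diff.simps(2))

lemma smooth_has_wirt: "smooth f \<Longrightarrow> has_wirt f (dz f z) (dbar 0 f z) z"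
  by (intro has_wirt_differentiable smooth_differentiable)

lemma smooth_continuous_on: "smooth f \<Longrightarrow> continuous_on S f"
  by (metis C_diff.simps(1) continuous_on_subset smooth_def subset_UNIV)

lemma has_vector_derivative_partial:
  assumes "f differentiable (at (z + of_real t * v))"
  shows "((\<lambda>t. f (z + of_real t * v)) has_vector_derivative partial_deriv v f (z + of_real t * v)) (at t within S)"
proof -
  let ?L = "frechet_derivative f (at (z + of_real t * v))"
  have "(f has_derivative ?L) (at (z + of_real t * v))"
    using assms by (simp add: frechet_derivative_works)
  moreover have "((\<lambda>t. z + of_real t * v) has_derivative (\<lambda>h. of_real h * v)) (at t within S)"
    by (auto intro!: derivative_eq_intros)
  ultimately have "((\<lambda>t. f (z + of_real t * v)) has_derivative (\<lambda>h. ?L (of_real h * v))) (at t within S)"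
    by (rule has_derivative_compose[rotated])
  moreover have "?L (of_real h * v) = h *\<^sub>R partial_deriv v f (z + of_real t * v)" for h
    using linear_scale[OF linear_frechet_derivative[OF assms], of h v]
    by (simp add: partial_deriv_def scaleR_conv_of_real)
  ultimately show ?thesis by (simp add: has_vector_derivative_def)
qed

text \<open>Integrate \<open>partial_deriv 1 f\<close> along a horizontal segment, differentiate
  vertically under the integral sign, and then differentiate in the length of the segment at
  0.\<close>

lemma partial_deriv_commute:
  assumes f: "smooth f"
  shows "partial_deriv 1 (partial_deriv \<i> f) z = partial_deriv \<i> (partial_deriv 1 f) z"
proof -
  let ?fx = "partial_deriv 1 f" and ?fy = "partial_deriv \<i> f"
  let ?fxy = "partial_deriv \<i> ?fx"
  note sm = smooth_partial_deriv[OF f]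
  note sm2 = smooth_partial_deriv[OF sm(1)]
  have line: "((\<lambda>t. g (w + of_real t * v)) has_vector_derivative partial_deriv v g (w + of_real t * v)) (at t within S)"
    if "smooth g" for g w v t S
    by (rule has_vector_derivative_partial[where f = g and z = w and v = v, OF smooth_differentiable[OF that]])
  have ftc: "((\<lambda>x. ?fx (z + of_real t * \<i> + of_real x)) has_integral
      (f (z + of_real t * \<i> + of_real s) - f (z + of_real t * \<i>))) {0..s}" if "0 \<le> s" for s t
    using fundamental_theorem_of_calculus[OF that line[OF f, where v = 1 and w = "z + of_real t * \<i>"]]
    by simp
  have key: "integral {0..s} (\<lambda>x. ?fxy (z + of_real x)) = ?fy (z + of_real s) - ?fy z" if s: "0 \<le> s" for s
  proof -
    have cont: "continuous_on (UNIV \<times> cbox 0 s) (\<lambda>(t, x). ?fxy (z + of_real x + of_real t * \<i>))"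
      unfolding split_def
      by (intro continuous_on_compose2[OF smooth_continuous_on[OF sm2(2), of UNIV]] continuous_intros) auto
    have eq: "integral (cbox 0 s) (\<lambda>x. ?fx (z + of_real x + of_real t * \<i>)) =
        f (z + of_real s + of_real t * \<i>) - f (z + of_real t * \<i>)" for t
      using integral_unique[OF ftc[OF s, of t]] by (simp add: add_ac)
    have int: "(\<lambda>x. ?fx (z + of_real x + of_real t * \<i>)) integrable_on cbox 0 s" for t
      using has_integral_integrable[OF ftc[OF s, of t]] by (simp add: add_ac)
    have "((\<lambda>t. integral (cbox 0 s) (\<lambda>x. ?fx (z + of_real x + of_real t * \<i>))) has_vector_derivative
       integral (cbox 0 s) (\<lambda>x. ?fxy (z + of_real x + of_real 0 * \<i>))) (at 0 within UNIV)"
      by (rule leibniz_rule_vector_derivative[where fx = "\<lambda>t x. ?fxy (z + of_real x + of_real t * \<i>)", OF line[OF sm(1)] int cont]) auto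
    then have "((\<lambda>t. f (z + of_real s + of_real t * \<i>) - f (z + of_real t * \<i>)) has_vector_derivative
        integral {0..s} (\<lambda>x. ?fxy (z + of_real x))) (at 0)"
      unfolding eq by simp
    moreover have "((\<lambda>t. f (z + of_real s + of_real t * \<i>) - f (z + of_real t * \<i>)) has_vector_derivative
       ?fy (z + of_real s + of_real 0 * \<i>) - ?fy (z + of_real 0 * \<i>)) (at 0 within UNIV)"
      by (rule has_vector_derivative_diff[OF line[OF f] line[OF f]])
    ultimately have "integral {0..s} (\<lambda>x. ?fxy (z + of_real x)) =
        ?fy (z + of_real s + of_real 0 * \<i>) - ?fy (z + of_real 0 * \<i>)"
      by (rule vector_derivative_unique_at)
    then show ?thesis by simp
  qed
  \<comment> \<open>\<open>key\<close> is available for s \<ge> 0 only, so both derivatives at 0 are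
    one-sided; they agree because 0 is a limit point of \<open>{0..1}\<close>.\<close>
  have "((\<lambda>s. integral {0..s} (\<lambda>x. ?fxy (z + of_real x))) has_vector_derivative ?fxy (z + of_real 0))
     (at 0 within {0..1})"
    by (intro integral_has_vector_derivative continuous_on_compose2[OF smooth_continuous_on[OF sm2(2), of UNIV]]
          continuous_intros) auto
  then have 1: "((\<lambda>s. ?fy (z + of_real s) - ?fy z) has_vector_derivative ?fxy (z + of_real 0)) (at 0 within {0..1})"
    by (rule has_vector_derivative_transform[rotated 2]) (use key in auto)
  have 2: "((\<lambda>s. ?fy (z + of_real s * 1) - ?fy z) has_vector_derivative partial_deriv 1 ?fy (z + of_real 0 * 1) - 0) (at 0 within {0..1})"
    by (rule has_vector_derivative_diff[OF line[OF sm(2)] has_vector_derivative_const])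
  have "at (0::real) within {0..1} \<noteq> bot"
    by (simp add: trivial_limit_within islimpt_Icc)
  from vector_derivative_unique_within[OF this 1 2[simplified mult_1_right]] show ?thesis
    by simp
qed

lemma partial_deriv_lincomb:
  assumes "smooth g" "smooth h"
  shows "partial_deriv v (\<lambda>z. (g z + c * h z) / 2) z = (partial_deriv v g z + c * partial_deriv v h z) / 2"
proof -
  have "(g has_derivative (\<lambda>v. partial_deriv v g z)) (at z)"
       "(h has_derivative (\<lambda>v. partial_deriv v h z)) (at z)"
    unfolding partial_deriv_def
    by (rule frechet_derivative_works[THEN iffD1, OF smooth_differentiable[OF assms(1)]],
        rule frechet_derivative_works[THEN iffD1, OF smooth_differentiable[OF assms(2)]])
  then have "((\<lambda>z. (g z + c * h z) / 2) has_derivative (\<lambda>v. (partial_deriv v g z + c * partial_deriv v h z) / 2)) (at z)"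
    by (auto intro!: derivative_eq_intros)
  from partial_deriv_eqI[OF this] show ?thesis .
qed

lemma dbar_dz_commute:
  assumes "smooth f"
  shows "dbar 0 (dz f) z = dz (dbar 0 f) z"
proof -
  note sm = smooth_partial_deriv[OF assms]
  have "dz f = (\<lambda>z. (partial_deriv 1 f z + (- \<i>) * partial_deriv \<i> f z) / 2)"
    by (simp add: dz_def)
  then have 1: "partial_deriv v (dz f) z = (partial_deriv v (partial_deriv 1 f) z + (- \<i>) * partial_deriv v (partial_deriv \<i> f) z) / 2" for v
    by (simp only: partial_deriv_lincomb[OF sm])
  have 2: "partial_deriv v (dbar 0 f) z = (partial_deriv v (partial_deriv 1 f) z + \<i> * partial_deriv v (partial_deriv \<i> f) z) / 2" for v
    unfolding dbar_def if_P[OF refl] by (rule partial_deriv_lincomb[OF sm])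
  have "dbar 0 (dz f) z = (partial_deriv 1 (dz f) z + \<i> * partial_deriv \<i> (dz f) z) / 2"
    by (simp add: dbar_def)
  moreover have "dz (dbar 0 f) z = (partial_deriv 1 (dbar 0 f) z - \<i> * partial_deriv \<i> (dbar 0 f) z) / 2"
    by (simp add: dz_def)
  ultimately have "dbar 0 (dz f) z - dz (dbar 0 f) z = 0"
    by (simp add: 1 2 partial_deriv_commute[OF assms] add_divide_distrib diff_divide_distrib algebra_simps)
  then show ?thesis by simp
qed

section \<open>Integration by parts on the projective line\<close>

text \<open>Boxes for the basis 1, \<open>\<i>\<close> determine the measure, and they are products
  of intervals. This makes Fubini's theorem available.\<close>

lemma lborel_complex: "(lborel :: complex measure) = distr (lborel \<Otimes>\<^sub>M lborel) borel (\<lambda>(x, y). Complex x y)"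
proof (rule lborel_eqI)
  have meas: "(\<lambda>(x, y). Complex x y) \<in> (lborel \<Otimes>\<^sub>M lborel) \<rightarrow>\<^sub>M borel"
    unfolding lborel_prod split_def measurable_cong_sets[OF sets_lborel refl]
    by (intro borel_measurable_continuous_onI continuous_intros)
  fix l u :: complex
  assume le: "\<And>b. b \<in> Basis \<Longrightarrow> l \<bullet> b \<le> u \<bullet> b"
  have "(\<lambda>(x, y). Complex x y) -` box l u = {Re l<..<Re u} \<times> {Im l<..<Im u}"
    by (auto simp: box_def Basis_complex_def)
  then show "emeasure (distr (lborel \<Otimes>\<^sub>M lborel) borel (\<lambda>(x, y). Complex x y)) (box l u) =
      (\<Prod>b\<in>Basis. (u - l) \<bullet> b)"
    using le[of 1] le[of \<i>]
    by (subst emeasure_distr[OF meas])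
       (auto simp: space_pair_measure lborel.emeasure_pair_measure_Times Basis_complex_def ennreal_mult)
qed simp

text \<open>
  A derivative of size \<open>|z|\<^sup>-\<^sup>3\<close> is dominated by \<open>decay (Re z) * decay (Im z)\<close>, which is
  integrable in each variable separately.
\<close>

definition decay :: "real \<Rightarrow> real" where "decay t = (1 + \<bar>t\<bar>) powr (- 3 / 2)"

lemma decay_measurable [measurable]: "decay \<in> borel_measurable borel"
  unfolding decay_def by measurable

lemma continuous_on_decay: "continuous_on S decay"
  unfolding decay_def by (intro continuous_intros) auto

lemma decay_pos: "decay t > 0"
  by (simp add: decay_def add_pos_nonneg)

text \<open>On each half-line there is an elementary antiderivative, a multiple of (1 + |t|)^(-1/2),
  with finite limits at both ends; the point 0 lost between the half-lines is null.\<close>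

lemma integrable_decay: "integrable lborel decay"
proof -
  have cont: "isCont decay x" for x
    using continuous_on_decay[of UNIV] by (simp add: continuous_on_eq_continuous_at)
  have 1: "set_integrable lborel (einterval 0 \<infinity>) decay"
  proof (rule interval_integral_FTC_nonneg(1)[where F = "\<lambda>t. - 2 * (1 + t) powr (- 1 / 2)" and A = "- 2" and B = 0])
    fix x :: real assume "0 < ereal x"
    then show "DERIV (\<lambda>t. - 2 * (1 + t) powr (- 1 / 2)) x :> decay x"
      by (auto intro!: derivative_eq_intros simp: decay_def)
  next
    have "((\<lambda>t::real. - 2 * (1 + t) powr (- 1 / 2)) \<longlongrightarrow> - 2 * (1 + 0) powr (- 1 / 2)) (at_right 0)"
      by (intro tendsto_intros) auto
    then show "(((\<lambda>t. - 2 * (1 + t) powr (- 1 / 2)) \<circ> real_of_ereal) \<longlongrightarrow> - 2) (at_right 0)"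
      by (simp add: ereal_tendsto_simps zero_ereal_def)
    have "((\<lambda>t::real. - 2 * (1 + t) powr (- 1 / 2)) \<longlongrightarrow> 0) at_top"
      by real_asymp
    then show "(((\<lambda>t. - 2 * (1 + t) powr (- 1 / 2)) \<circ> real_of_ereal) \<longlongrightarrow> 0) (at_left \<infinity>)"
      by (simp add: ereal_tendsto_simps)
  qed (auto simp: cont less_imp_le[OF decay_pos])
  have 2: "set_integrable lborel (einterval (- \<infinity>) 0) decay"
  proof (rule interval_integral_FTC_nonneg(1)[where F = "\<lambda>t. 2 * (1 - t) powr (- 1 / 2)" and A = 0 and B = 2])
    fix x :: real assume "ereal x < 0"
    then show "DERIV (\<lambda>t. 2 * (1 - t) powr (- 1 / 2)) x :> decay x"
      by (auto intro!: derivative_eq_intros simp: decay_def)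
  next
    have "((\<lambda>t::real. 2 * (1 - t) powr (- 1 / 2)) \<longlongrightarrow> 2 * (1 - 0) powr (- 1 / 2)) (at_left 0)"
      by (intro tendsto_intros) auto
    then show "(((\<lambda>t. 2 * (1 - t) powr (- 1 / 2)) \<circ> real_of_ereal) \<longlongrightarrow> 2) (at_left 0)"
      by (simp add: ereal_tendsto_simps zero_ereal_def)
    have "((\<lambda>t::real. 2 * (1 - t) powr (- 1 / 2)) \<longlongrightarrow> 0) at_bot"
      by real_asymp
    then show "(((\<lambda>t. 2 * (1 - t) powr (- 1 / 2)) \<circ> real_of_ereal) \<longlongrightarrow> 0) (at_right (- \<infinity>))"
      by (simp add: ereal_tendsto_simps)
  qed (auto simp: cont less_imp_le[OF decay_pos])
  have "set_integrable lborel (einterval 0 \<infinity> \<union> einterval (- \<infinity>) 0) decay"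
    by (rule set_integrable_Un[OF 1 2]) auto
  moreover have "AE x in lborel. indicator (einterval 0 \<infinity> \<union> einterval (- \<infinity>) 0) x *\<^sub>R decay x = decay x"
    using AE_lborel_singleton[of "0::real"] by eventually_elim (auto simp: indicator_def einterval_def)
  ultimately show ?thesis
    unfolding set_integrable_def by (subst (asm) integrable_cong_AE) auto
qed

text \<open>Both orders of iteration are provided because the two partial derivatives are integrated
  first along different axes. The bound factors, so each slice is dominated by a multiple of
  \<open>decay\<close>.\<close>

lemma
  fixes h :: "complex \<Rightarrow> complex"
  assumes cont: "continuous_on UNIV h"
    and bound: "\<And>z. norm (h z) \<le> C * (decay (Re z) * decay (Im z))"
  shows integrable_decay_bound: "integrable lborel h"
    and integral_iterated: "(LINT z|lborel. h z) = (LINT y|lborel. LINT x|lborel. h (Complex x y))"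
    and integral_iterated': "(LINT z|lborel. h z) = (LINT x|lborel. LINT y|lborel. h (Complex x y))"
    and integrable_line: "integrable lborel (\<lambda>x. h (Complex x y))"
    and integrable_line': "integrable lborel (\<lambda>y. h (Complex x y))"
proof -
  have [measurable]: "h \<in> borel_measurable borel"
    by (rule borel_measurable_continuous_onI[OF cont])
  have meas [measurable]: "(\<lambda>(x, y). Complex x y) \<in> (lborel \<Otimes>\<^sub>M lborel) \<rightarrow>\<^sub>M borel"
    unfolding lborel_prod split_def measurable_cong_sets[OF sets_lborel refl]
    by (intro borel_measurable_continuous_onI continuous_intros)
  have "0 \<le> C"
    using order_trans[OF norm_ge_zero bound[of 0]] mult_pos_pos[OF decay_pos[of 0] decay_pos[of 0]]
    by (auto simp: zero_le_mult_iff)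
  have dom: "integrable (lborel \<Otimes>\<^sub>M lborel) (\<lambda>(x, y). C * (decay x * decay y))"
    by (intro lborel_pair.Fubini_integrable)
       (auto intro!: integrable_decay simp: \<open>0 \<le> C\<close> less_imp_le[OF decay_pos] abs_mult split_def)
  have int: "integrable (lborel \<Otimes>\<^sub>M lborel) (\<lambda>(x, y). h (Complex x y))"
    by (rule Bochner_Integration.integrable_bound[OF dom])
       (use bound in \<open>auto simp: split_def intro!: order_trans[OF bound]\<close>)
  show "integrable lborel h"
    unfolding lborel_complex using int by (subst integrable_distr_eq) (auto simp: split_def)
  have eq: "(LINT z|lborel. h z) = (LINT z|(lborel \<Otimes>\<^sub>M lborel). (\<lambda>(x, y). h (Complex x y)) z)"
    unfolding lborel_complex by (subst integral_distr) (auto simp: split_def)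
  show "(LINT z|lborel. h z) = (LINT y|lborel. LINT x|lborel. h (Complex x y))"
    unfolding eq by (rule lborel_pair.integral_snd[OF int, symmetric])
  show "(LINT z|lborel. h z) = (LINT x|lborel. LINT y|lborel. h (Complex x y))"
    unfolding eq by (rule lborel_pair.integral_fst[OF int, symmetric])
  have b: "cmod (h (Complex x y)) \<le> C * (decay x * decay y)" for x y
    using bound[of "Complex x y"] by simp
  show "integrable lborel (\<lambda>x. h (Complex x y))"
    by (rule Bochner_Integration.integrable_bound[of _ "\<lambda>x. (C * decay y) * decay x"])
       (auto simp: integrable_decay mult_ac intro!: AE_I2 order_trans[OF b abs_ge_self])
  show "integrable lborel (\<lambda>y. h (Complex x y))"
    by (rule Bochner_Integration.integrable_bound[of _ "\<lambda>y. (C * decay x) * decay y"])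
       (auto simp: integrable_decay mult.assoc intro!: AE_I2 order_trans[OF b abs_ge_self])
qed

lemma integral_derivative_line:
  fixes g :: "real \<Rightarrow> complex"
  assumes "\<And>t. (g has_vector_derivative g' t) (at t)" "continuous_on UNIV g'"
    "integrable lborel g'" "(g \<longlongrightarrow> 0) at_top" "(g \<longlongrightarrow> 0) at_bot"
  shows "(LINT t|lborel. g' t) = 0"
proof -
  have "(LBINT t=-\<infinity>..\<infinity>. g' t) = 0 - 0"
    by (rule interval_integral_FTC_integrable[where F = g])
       (use assms in \<open>auto simp: set_integrable_def ereal_tendsto_simps continuous_on_eq_continuous_at einterval_def\<close>)
  then show ?thesis
    by (simp add: interval_lebesgue_integral_def einterval_def set_lebesgue_integral_def)
qed

text \<open>Both coordinates are at most |z| in size, so (1 + |Re z|)(1 + |Im z|) is at most (1 +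
  |z|)^2; the exponent -3/2 turns the square into the cube.\<close>

lemma decay_prod_ge: "1 / (1 + cmod z) ^ 3 \<le> decay (Re z) * decay (Im z)"
proof -
  have "(1 + \<bar>Re z\<bar>) * (1 + \<bar>Im z\<bar>) \<le> (1 + cmod z) * (1 + cmod z)"
    by (intro mult_mono) (auto simp: abs_Re_le_cmod abs_Im_le_cmod)
  then have "((1 + cmod z) * (1 + cmod z)) powr (- 3 / 2) \<le> ((1 + \<bar>Re z\<bar>) * (1 + \<bar>Im z\<bar>)) powr (- 3 / 2)"
    by (intro powr_mono2') (auto intro!: mult_pos_pos add_pos_nonneg)
  also have "\<dots> = decay (Re z) * decay (Im z)"
    by (simp add: decay_def powr_mult)
  also have "((1 + cmod z) * (1 + cmod z)) powr (- 3 / 2) = (1 + cmod z) powr (- 3)"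
    by (simp add: powr_mult add_pos_nonneg flip: powr_add)
  also have "\<dots> = 1 / (1 + cmod z) ^ 3"
    by (simp add: powr_minus_divide add_pos_nonneg)
  finally show ?thesis by simp
qed

text \<open>The discs |z| \<le> 1 and |w| \<le> 1 cover the projective line, so bounds of this kind
  in the two charts control a section or form globally.\<close>

lemma bounded_continuous_unit_disc:
  fixes f :: "complex \<Rightarrow> complex"
  assumes "continuous_on UNIV f"
  obtains K where "K \<ge> 0" "\<And>z. cmod z \<le> 1 \<Longrightarrow> cmod (f z) \<le> K"
proof -
  have "compact (f ` cball 0 1)"
    by (intro compact_continuous_image continuous_on_subset[OF assms]) auto
  then obtain K where "\<forall>w\<in>f ` cball 0 1. cmod w \<le> K"
    using bounded_iff compact_imp_bounded by metis
  then have "\<And>z. cmod z \<le> 1 \<Longrightarrow> cmod (f z) \<le> max K 0"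
    by (fastforce simp: le_max_iff_disj)
  then show ?thesis using that[of "max K 0"] by simp
qed

text \<open>
  The hypothesis relating \<open>F\<close> and \<open>G\<close> says that \<open>F dz\<close> is a smooth form on the projective line, with
  coefficient \<open>- G\<close> in the \<open>w\<close>-chart; so the vanishing of the integral below is Stokes' theorem.
\<close>

context
  fixes F G :: "complex \<Rightarrow> complex"
  assumes F: "smooth F" and G: "smooth G" and FG: "\<And>z. z \<noteq> 0 \<Longrightarrow> F z = G (1 / z) / z ^ 2"
begin

lemma weight_two_has_wirt:
  assumes z: "z \<noteq> 0"
  shows "dz F z = - dz G (1 / z) / z ^ 4 - 2 * G (1 / z) / z ^ 3"
    and "dbar 0 F z = - dbar 0 G (1 / z) / (cnj z ^ 2 * z ^ 2)"
proof -
  have inv: "((\<lambda>z. 1 / z) has_field_derivative - 1 / z ^ 2) (at z)"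
    using z by (auto intro!: derivative_eq_intros simp: power2_eq_square)
  have sq: "((\<lambda>z. 1 / z ^ 2) has_field_derivative - 2 / z ^ 3) (at z)"
    using z by (auto intro!: derivative_eq_intros simp: field_simps eval_nat_numeral)
  have "has_wirt (\<lambda>z. G (1 / z) * (1 / z ^ 2))
     (dz G (1 / z) * (- 1 / z ^ 2) * (1 / z ^ 2) + G (1 / z) * (- 2 / z ^ 3))
     (dbar 0 G (1 / z) * cnj (- 1 / z ^ 2) * (1 / z ^ 2) + G (1 / z) * 0) z"
    by (intro has_wirt_mult has_wirt_compose_field[OF smooth_has_wirt[OF G] inv] has_wirt_field sq)
  from has_wirt_cong_open[OF this, of "- {0}" F] z FG
  have w: "has_wirt F
     (dz G (1 / z) * (- 1 / z ^ 2) * (1 / z ^ 2) + G (1 / z) * (- 2 / z ^ 3))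
     (dbar 0 G (1 / z) * cnj (- 1 / z ^ 2) * (1 / z ^ 2) + G (1 / z) * 0) z"
    by auto
  show "dz F z = - dz G (1 / z) / z ^ 4 - 2 * G (1 / z) / z ^ 3"
    using has_wirt_dz[OF w] z by (simp add: field_simps eval_nat_numeral)
  show "dbar 0 F z = - dbar 0 G (1 / z) / (cnj z ^ 2 * z ^ 2)"
    using has_wirt_dbar[OF w] z by (simp add: field_simps)
qed

text \<open>Outside the unit disc F is G(1/z)/z^2. Differentiating z^-2 gives order |z|^-3; the
  other contributions have order |z|^-4 and are absorbed because |z| > 1.\<close>

lemma weight_two_decay:
  obtains C where "\<And>z v. cmod v = 1 \<Longrightarrow> cmod (partial_deriv v F z) \<le> C * (decay (Re z) * decay (Im z))"
proof -
  obtain A where A: "A \<ge> 0" "\<And>z. cmod z \<le> 1 \<Longrightarrow> cmod (dz F z) \<le> A"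
    using bounded_continuous_unit_disc smooth_continuous_on[OF smooth_dz[OF F]] by metis
  obtain B where B: "B \<ge> 0" "\<And>z. cmod z \<le> 1 \<Longrightarrow> cmod (dbar 0 F z) \<le> B"
    using bounded_continuous_unit_disc smooth_continuous_on[OF smooth_dbar[OF F]] by metis
  obtain K where K: "K \<ge> 0" "\<And>z. cmod z \<le> 1 \<Longrightarrow> cmod (G z) \<le> K"
    using bounded_continuous_unit_disc smooth_continuous_on[OF G] by metis
  obtain A' where A': "A' \<ge> 0" "\<And>z. cmod z \<le> 1 \<Longrightarrow> cmod (dz G z) \<le> A'"
    using bounded_continuous_unit_disc smooth_continuous_on[OF smooth_dz[OF G]] by metis
  obtain B' where B': "B' \<ge> 0" "\<And>z. cmod z \<le> 1 \<Longrightarrow> cmod (dbar 0 G z) \<le> B'"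
    using bounded_continuous_unit_disc smooth_continuous_on[OF smooth_dbar[OF G]] by metis
  define M where "M = A + B + (A' + 2 * K + B')"
  have M: "cmod (dz F z) + cmod (dbar 0 F z) \<le> (8 * M) * (1 / (1 + cmod z) ^ 3)" for z
  proof (cases "cmod z \<le> 1")
    case True
    have "(1 + cmod z) ^ 3 \<le> 2 ^ 3"
      using True by (intro power_mono) auto
    then have "1 \<le> 8 * (1 / (1 + cmod z) ^ 3)"
      by (simp add: field_simps add_pos_nonneg)
    have "cmod (dz F z) + cmod (dbar 0 F z) \<le> M * 1"
      using A(2)[OF True] B(2)[OF True] A'(1) B'(1) K(1) by (simp add: M_def)
    also have "\<dots> \<le> M * (8 * (1 / (1 + cmod z) ^ 3))"
      by (intro mult_left_mono) (use \<open>1 \<le> _\<close> A(1) B(1) A'(1) B'(1) K(1) in \<open>auto simp: M_def\<close>)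
    finally show ?thesis by (simp add: mult_ac)
  next
    case False
    then have z: "cmod z > 1" "z \<noteq> 0" by auto
    have iz: "cmod (1 / z) \<le> 1" using z by (simp add: norm_divide)
    have p4: "1 / cmod z ^ 4 \<le> 1 / cmod z ^ 3"
      using z by (intro divide_left_mono power_increasing mult_pos_pos) auto
    \<comment> \<open>Here 1 + |z| \<le> 2 |z|. The factor 8 in the bound is 2^3 on both sides of
      the unit circle.\<close>
    have "(1 + cmod z) ^ 3 \<le> (2 * cmod z) ^ 3"
      using z by (intro power_mono) auto
    then have p3: "1 / cmod z ^ 3 \<le> 8 * (1 / (1 + cmod z) ^ 3)"
      using z by (simp add: field_simps add_pos_nonneg)
    have "cmod (dz F z) \<le> cmod (dz G (1 / z)) / cmod z ^ 4 + 2 * cmod (G (1 / z)) / cmod z ^ 3"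
      unfolding weight_two_has_wirt(1)[OF z(2)]
      by (rule order_trans[OF norm_triangle_ineq4]) (simp add: norm_divide norm_mult norm_power)
    also have "\<dots> \<le> A' * (1 / cmod z ^ 4) + 2 * K * (1 / cmod z ^ 3)"
      using A'(2)[OF iz] K(2)[OF iz] by (auto intro!: add_mono divide_right_mono)
    also have "\<dots> \<le> A' * (1 / cmod z ^ 3) + 2 * K * (1 / cmod z ^ 3)"
      using p4 A'(1) K(1) by (intro add_mono mult_left_mono) auto
    finally have d1: "cmod (dz F z) \<le> (A' + 2 * K) * (1 / cmod z ^ 3)"
      by (simp add: algebra_simps add_divide_distrib)
    have "cmod (dbar 0 F z) = cmod (dbar 0 G (1 / z)) * (1 / cmod z ^ 4)"
      unfolding weight_two_has_wirt(2)[OF z(2)]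
      by (simp add: norm_divide norm_mult norm_power flip: power_add)
    also have "\<dots> \<le> B' * (1 / cmod z ^ 3)"
      using p4 B'(1) B'(2)[OF iz] by (intro mult_mono) auto
    finally have "cmod (dz F z) + cmod (dbar 0 F z) \<le> (A' + 2 * K + B') * (1 / cmod z ^ 3)"
      using d1 by (simp add: algebra_simps add_divide_distrib)
    also have "\<dots> \<le> M * (8 * (1 / (1 + cmod z) ^ 3))"
      by (intro mult_mono p3) (use A(1) B(1) A'(1) B'(1) K(1) in \<open>auto simp: M_def\<close>)
    finally show ?thesis by (simp add: mult_ac)
  qed
  have "cmod (partial_deriv v F z) \<le> (8 * M) * (decay (Re z) * decay (Im z))" if v: "cmod v = 1" for z v
  proof -
    have "cmod (partial_deriv v F z) \<le> cmod (dz F z) + cmod (dbar 0 F z)"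
      unfolding has_wirt_partial[OF smooth_has_wirt[OF F]]
      by (rule order_trans[OF norm_triangle_ineq]) (simp add: norm_mult v)
    also note M[of z]
    also have "(8 * M) * (1 / (1 + cmod z) ^ 3) \<le> (8 * M) * (decay (Re z) * decay (Im z))"
      by (intro mult_left_mono decay_prod_ge) (use A(1) B(1) A'(1) B'(1) K(1) in \<open>auto simp: M_def\<close>)
    finally show ?thesis .
  qed
  then show ?thesis by (rule that)
qed

text \<open>The curve \<open>c\<close> stands for a horizontal or vertical line at any offset; the
  hypothesis is what these lines share, and it bounds \<open>F (c t)\<close> by a multiple of
  1/t^2.\<close>

lemma weight_two_tendsto_0:
  fixes c :: "real \<Rightarrow> complex"
  assumes c: "\<And>t. \<bar>t\<bar> \<le> cmod (c t)"
  shows "((\<lambda>t. F (c t)) \<longlongrightarrow> 0) at_top" "((\<lambda>t. F (c t)) \<longlongrightarrow> 0) at_bot"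
proof -
  obtain K where K: "K \<ge> 0" "\<And>z. cmod z \<le> 1 \<Longrightarrow> cmod (G z) \<le> K"
    using bounded_continuous_unit_disc smooth_continuous_on[OF G] by metis
  have b: "cmod (F (c t)) \<le> K / t ^ 2" if t: "\<bar>t\<bar> \<ge> 1" for t
  proof -
    have ct: "c t \<noteq> 0" "cmod (1 / c t) \<le> 1"
      using c[of t] t by (auto simp: norm_divide divide_le_eq_1)
    have "\<bar>t\<bar> ^ 2 \<le> cmod (c t) ^ 2"
      by (intro power_mono c) auto
    then have "cmod (G (1 / c t)) / cmod (c t) ^ 2 \<le> K / \<bar>t\<bar> ^ 2"
      using K(1) K(2)[OF ct(2)] t by (intro frac_le) auto
    then show ?thesis
      by (simp add: FG[OF ct(1)] norm_divide norm_power)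
  qed
  have "eventually (\<lambda>t::real. \<bar>t\<bar> \<ge> 1) at_top"
    using eventually_ge_at_top[of 1] by eventually_elim auto
  then have "eventually (\<lambda>t::real. cmod (F (c t)) \<le> K / t ^ 2) at_top"
    by eventually_elim (rule b)
  moreover have "((\<lambda>t::real. K / t ^ 2) \<longlongrightarrow> 0) at_top" by real_asymp
  ultimately show "((\<lambda>t. F (c t)) \<longlongrightarrow> 0) at_top" by (rule Lim_null_comparison)
  have "eventually (\<lambda>t::real. \<bar>t\<bar> \<ge> 1) at_bot"
    using eventually_le_at_bot[of "- 1"] by eventually_elim auto
  then have "eventually (\<lambda>t::real. cmod (F (c t)) \<le> K / t ^ 2) at_bot"
    by eventually_elim (rule b)
  moreover have "((\<lambda>t::real. K / t ^ 2) \<longlongrightarrow> 0) at_bot" by real_asymp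
  ultimately show "((\<lambda>t. F (c t)) \<longlongrightarrow> 0) at_bot" by (rule Lim_null_comparison)
qed

text \<open>\<open>partial_deriv 1 F\<close> is integrated first along horizontals and
  \<open>partial_deriv \<i> F\<close> first along verticals. Each inner integral vanishes by the
  fundamental theorem of calculus, as F tends to 0 at both ends.\<close>

lemma weight_two_integral_dbar:
  shows "integrable lborel (dbar 0 F)" "(LINT z|lborel. dbar 0 F z) = 0"
proof -
  obtain C where C: "\<And>z v. cmod v = 1 \<Longrightarrow> cmod (partial_deriv v F z) \<le> C * (decay (Re z) * decay (Im z))"
    by (rule weight_two_decay) blast
  note c1 = smooth_continuous_on[OF smooth_partial_deriv(1)[OF F], of UNIV]
  note ci = smooth_continuous_on[OF smooth_partial_deriv(2)[OF F], of UNIV]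
  note b1 = C[of 1, simplified]
  note bi = C[of \<i>, simplified]
  have line: "((\<lambda>t. F (w + of_real t * v)) has_vector_derivative partial_deriv v F (w + of_real t * v)) (at t)" for w v t
    by (rule has_vector_derivative_partial[where f = F and z = w and v = v, OF smooth_differentiable[OF F]])
  have "(LINT x|lborel. partial_deriv 1 F (Complex x y)) = 0" for y
  proof (rule integral_derivative_line)
    show "((\<lambda>x. F (Complex x y)) has_vector_derivative partial_deriv 1 F (Complex x y)) (at x)" for x
      using line[of "Complex 0 y" 1 x] by (simp add: Complex_eq add_ac)
    show "continuous_on UNIV (\<lambda>x. partial_deriv 1 F (Complex x y))"
      by (intro continuous_on_compose2[OF c1] continuous_intros) auto
    show "integrable lborel (\<lambda>x. partial_deriv 1 F (Complex x y))"
      by (rule integrable_line[OF c1 b1])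
    have "\<bar>x\<bar> \<le> cmod (Complex x y)" for x using abs_Re_le_cmod[of "Complex x y"] by simp
    from weight_two_tendsto_0[OF this]
    show "((\<lambda>x. F (Complex x y)) \<longlongrightarrow> 0) at_top" "((\<lambda>x. F (Complex x y)) \<longlongrightarrow> 0) at_bot" .
  qed
  then have 1: "(LINT z|lborel. partial_deriv 1 F z) = 0"
    by (subst integral_iterated[OF c1 b1]) simp
  have "(LINT y|lborel. partial_deriv \<i> F (Complex x y)) = 0" for x
  proof (rule integral_derivative_line)
    show "((\<lambda>y. F (Complex x y)) has_vector_derivative partial_deriv \<i> F (Complex x y)) (at y)" for y
      using line[of "Complex x 0" \<i> y] by (simp add: Complex_eq mult_ac)
    show "continuous_on UNIV (\<lambda>y. partial_deriv \<i> F (Complex x y))"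
      by (intro continuous_on_compose2[OF ci] continuous_intros) auto
    show "integrable lborel (\<lambda>y. partial_deriv \<i> F (Complex x y))"
      by (rule integrable_line'[OF ci bi])
    have "\<bar>y\<bar> \<le> cmod (Complex x y)" for y using abs_Im_le_cmod[of "Complex x y"] by simp
    from weight_two_tendsto_0[OF this]
    show "((\<lambda>y. F (Complex x y)) \<longlongrightarrow> 0) at_top" "((\<lambda>y. F (Complex x y)) \<longlongrightarrow> 0) at_bot" .
  qed
  then have 2: "(LINT z|lborel. partial_deriv \<i> F z) = 0"
    by (subst integral_iterated'[OF ci bi]) simp
  note int = integrable_decay_bound[OF c1 b1] integrable_decay_bound[OF ci bi]
  show "integrable lborel (dbar 0 F)"
    unfolding dbar_def using int by simp
  show "(LINT z|lborel. dbar 0 F z) = 0"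
    unfolding dbar_def using int 1 2 by simp
qed

end

section \<open>Raising and lowering operators\<close>

definition rho :: "complex \<Rightarrow> complex" where "rho z = 1 + z * cnj z"

definition raise_op :: "(complex \<Rightarrow> complex) \<Rightarrow> complex \<Rightarrow> complex" where
  "raise_op u = (\<lambda>z. rho z ^ 2 * dbar 0 u z)"

text \<open>This is -rho^(b+2) dz (u / rho^(b+2)), minus the (1,0)-part of the Chern connection of
  O(b+2) in the frame of the z-chart. The index b is the degree of the target.\<close>

definition lower_op :: "nat \<Rightarrow> (complex \<Rightarrow> complex) \<Rightarrow> complex \<Rightarrow> complex" where
  "lower_op b u = (\<lambda>z. of_nat (b + 2) * cnj z / rho z * u z - dz u z)"

definition sec_inner :: "nat \<Rightarrow> (complex \<Rightarrow> complex) \<Rightarrow> (complex \<Rightarrow> complex) \<Rightarrow> complex" where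
  "sec_inner b f g = (LINT z|lborel. f z * cnj (g z) / (of_real pi * rho z ^ (b + 2)))"

lemma rho_of_real: "rho z = of_real (1 + (cmod z)\<^sup>2)"
  by (simp only: rho_def of_real_add of_real_1 complex_norm_square)

lemma rho_nonzero [simp]: "rho z \<noteq> 0"
proof -
  have "1 + (cmod z)\<^sup>2 \<noteq> 0" by (simp add: add_nonneg_eq_0_iff)
  then show ?thesis unfolding rho_of_real of_real_eq_0_iff .
qed

lemma cnj_rho [simp]: "cnj (rho z) = rho z"
  by (simp add: rho_of_real)

lemma cmod_rho: "cmod (rho z) = 1 + (cmod z)\<^sup>2"
  unfolding rho_of_real by (simp del: of_real_add add: add_nonneg_nonneg)

lemma rho_inverse: "z \<noteq> 0 \<Longrightarrow> rho (1 / z) = rho z / (z * cnj z)"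
  by (simp add: rho_def field_simps)

lemma smooth_rho [intro]: "smooth rho"
  unfolding rho_def by (intro smooth_add smooth_mult smooth_cnj smooth_const smooth_id)

lemma has_wirt_rho: "has_wirt rho (cnj z) z z"
proof -
  have "has_wirt (\<lambda>z. 1 + z * cnj z) (0 + (1 * cnj z + z * cnj 0)) (0 + (0 * cnj z + z * cnj 1)) z"
    by (intro has_wirt_add has_wirt_mult has_wirt_cnj has_wirt_const has_wirt_field DERIV_ident)
  moreover have "(\<lambda>z. 1 + z * cnj z) = rho" by (simp add: rho_def fun_eq_iff)
  ultimately show ?thesis by simp
qed

lemma has_wirt_inverse_rho_power:
  "has_wirt (\<lambda>z. 1 / rho z ^ n) (- of_nat n / rho z ^ (n + 1) * cnj z) (- of_nat n / rho z ^ (n + 1) * z) z"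
proof (rule has_wirt_field_compose[OF has_wirt_rho])
  have pow: "((\<lambda>w. w ^ n) has_field_derivative of_nat n * (1 * rho z ^ (n - Suc 0))) (at (rho z))"
    by (rule DERIV_power[OF DERIV_ident])
  show "((\<lambda>w. 1 / w ^ n) has_field_derivative - of_nat n / rho z ^ (n + 1)) (at (rho z))"
    by (rule DERIV_cong[OF DERIV_divide[OF DERIV_const pow]]) (cases n; simp add: field_simps)+
qed

lemma forms_0_iff:
  "f \<in> forms b 0 \<longleftrightarrow> smooth f \<and> (\<exists>g. smooth g \<and> (\<forall>z. z \<noteq> 0 \<longrightarrow> f z = z ^ b * g (1 / z)))"
  by (simp add: forms_def)

lemma forms_1_iff:
  "f \<in> forms b 1 \<longleftrightarrow>
     smooth f \<and> (\<exists>g. smooth g \<and> (\<forall>z. z \<noteq> 0 \<longrightarrow> f z = - (z ^ b / cnj z ^ 2) * g (1 / z)))"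
  by (simp add: forms_def)

lemma forms_0_smooth: "f \<in> forms b 0 \<Longrightarrow> smooth f"
  by (simp add: forms_0_iff)

text \<open>The factor rho^2 trades the antiholomorphic transition factor for a holomorphic one:
  rho(1/z) is rho(z) / (z cnj z), so its square absorbs the division by (cnj z)^2 and leaves an
  extra z^2.\<close>

lemma form_1_section_iff: "f \<in> forms b 1 \<longleftrightarrow> (\<lambda>z. rho z ^ 2 * f z) \<in> forms (b + 2) 0"
proof
  assume "f \<in> forms b 1"
  then obtain g where f: "smooth f" and g: "smooth g" "\<And>z. z \<noteq> 0 \<Longrightarrow> f z = - (z ^ b / cnj z ^ 2) * g (1 / z)"
    unfolding forms_1_iff by auto
  have "rho z ^ 2 * f z = z ^ (b + 2) * (- (rho (1 / z) ^ 2) * g (1 / z))" if "z \<noteq> 0" for z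
    using that by (simp add: g(2) rho_inverse field_simps power2_eq_square)
  moreover have "smooth (\<lambda>z. rho z ^ 2 * f z)" "smooth (\<lambda>z. - (rho z ^ 2) * g z)"
    by (intro smooth_mult smooth_minus smooth_power smooth_rho f g)+
  ultimately show "(\<lambda>z. rho z ^ 2 * f z) \<in> forms (b + 2) 0"
    unfolding forms_0_iff by (intro conjI exI[of _ "\<lambda>z. - (rho z ^ 2) * g z"]) auto
next
  assume "(\<lambda>z. rho z ^ 2 * f z) \<in> forms (b + 2) 0"
  then obtain g where f: "smooth (\<lambda>z. rho z ^ 2 * f z)"
    and g: "smooth g" "\<And>z. z \<noteq> 0 \<Longrightarrow> rho z ^ 2 * f z = z ^ (b + 2) * g (1 / z)"
    by (auto simp: forms_0_iff)
  have "f z = - (z ^ b / cnj z ^ 2) * - (g (1 / z) / rho (1 / z) ^ 2)" if "z \<noteq> 0" for z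
  proof -
    have "f z = z ^ (b + 2) * g (1 / z) / rho z ^ 2"
      using g(2)[OF that] by (simp add: field_simps)
    then show ?thesis using that by (simp add: rho_inverse field_simps power2_eq_square)
  qed
  moreover have "smooth (\<lambda>z. (rho z ^ 2 * f z) / rho z ^ 2)" "smooth (\<lambda>z. - (g z / rho z ^ 2))"
    by (intro smooth_divide smooth_minus smooth_power smooth_rho f g; simp)+
  ultimately show "f \<in> forms b 1"
    unfolding forms_1_iff by (intro conjI exI[of _ "\<lambda>z. - (g z / rho z ^ 2)"]) auto
qed

lemma section_derivs:
  assumes g: "smooth g" and fg: "\<And>z. z \<noteq> 0 \<Longrightarrow> f z = z ^ b * g (1 / z)" and z: "z \<noteq> 0"
  shows "dz f z = of_nat b * z ^ b / z * g (1 / z) - z ^ b / z ^ 2 * dz g (1 / z)"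
    and "dbar 0 f z = - (z ^ b / cnj z ^ 2) * dbar 0 g (1 / z)"
proof -
  have inv: "((\<lambda>z. 1 / z) has_field_derivative - 1 / z ^ 2) (at z)"
    using z by (auto intro!: derivative_eq_intros simp: power2_eq_square)
  have "((\<lambda>z. z ^ b) has_field_derivative of_nat b * (1 * z ^ (b - Suc 0))) (at z)"
    by (rule DERIV_power[OF DERIV_ident])
  then have pow: "((\<lambda>z. z ^ b) has_field_derivative of_nat b * z ^ b / z) (at z)"
    using z by (cases b) auto
  have "has_wirt (\<lambda>z. z ^ b * g (1 / z))
     (of_nat b * z ^ b / z * g (1 / z) + z ^ b * (dz g (1 / z) * (- 1 / z ^ 2)))
     (0 * g (1 / z) + z ^ b * (dbar 0 g (1 / z) * cnj (- 1 / z ^ 2))) z"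
    by (intro has_wirt_mult has_wirt_compose_field[OF smooth_has_wirt[OF g] inv] has_wirt_field pow)
  from has_wirt_cong_open[OF this, of "- {0}" f] z fg
  have w: "has_wirt f
     (of_nat b * z ^ b / z * g (1 / z) + z ^ b * (dz g (1 / z) * (- 1 / z ^ 2)))
     (0 * g (1 / z) + z ^ b * (dbar 0 g (1 / z) * cnj (- 1 / z ^ 2))) z"
    by auto
  show "dz f z = of_nat b * z ^ b / z * g (1 / z) - z ^ b / z ^ 2 * dz g (1 / z)"
    using has_wirt_dz[OF w] by simp
  show "dbar 0 f z = - (z ^ b / cnj z ^ 2) * dbar 0 g (1 / z)"
    using has_wirt_dbar[OF w] by simp
qed

lemma raise_op_smooth: "smooth u \<Longrightarrow> smooth (raise_op u)"
  unfolding raise_op_def by (intro smooth_mult smooth_power smooth_rho smooth_dbar)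

lemma lower_op_smooth: "smooth u \<Longrightarrow> smooth (lower_op b u)"
  unfolding lower_op_def
  by (intro smooth_mult smooth_diff smooth_divide smooth_rho smooth_dz smooth_const smooth_cnj smooth_id; simp)

lemma raise_op_section:
  assumes "u \<in> forms b 0"
  shows "raise_op u \<in> forms (b + 2) 0"
proof -
  from assms obtain g where u: "smooth u" and g: "smooth g" "\<And>z. z \<noteq> 0 \<Longrightarrow> u z = z ^ b * g (1 / z)"
    by (auto simp: forms_0_iff)
  have "raise_op u z = z ^ (b + 2) * - raise_op g (1 / z)" if z: "z \<noteq> 0" for z
  proof -
    have D: "dbar 0 u z = - (z ^ b / cnj z ^ 2) * dbar 0 g (1 / z)"
      by (rule section_derivs(2)[OF g(1) _ z]) (rule g(2))
    show ?thesis unfolding raise_op_def D using z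
      by (simp add: rho_inverse field_simps power2_eq_square)
  qed
  then show ?thesis
    unfolding forms_0_iff
    by (intro conjI exI[of _ "\<lambda>z. - raise_op g z"] raise_op_smooth u smooth_minus g) auto
qed

text \<open>Differentiating z^(b+2) in the gluing condition produces a term without a derivative of
  g; with the connection term of the z-chart it combines to that of the w-chart. As for
  \<open>raise_op\<close>, the operator reappears there up to the sign of d(1/z)/dz.\<close>

lemma lower_op_section:
  assumes "u \<in> forms (b + 2) 0"
  shows "lower_op b u \<in> forms b 0"
proof -
  from assms obtain g where u: "smooth u" and g: "smooth g" "\<And>z. z \<noteq> 0 \<Longrightarrow> u z = z ^ (b + 2) * g (1 / z)"
    by (auto simp: forms_0_iff)
  have "lower_op b u z = z ^ b * - lower_op b g (1 / z)" if z: "z \<noteq> 0" for z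
  proof -
    define c where "c = (of_nat (b + 2) :: complex)"
    have 1: "cnj z * z = rho z - 1" by (simp add: rho_def)
    have 2: "cnj (1 / z) / rho (1 / z) = z / rho z"
      using z by (simp add: rho_inverse)
    have 3: "lower_op b g (1 / z) = c * (z / rho z) * g (1 / z) - dz g (1 / z)"
      unfolding lower_op_def by (simp only: c_def flip: 2) simp
    have D: "dz u z = of_nat (b + 2) * z ^ (b + 2) / z * g (1 / z) - z ^ (b + 2) / z ^ 2 * dz g (1 / z)"
      by (rule section_derivs(1)[OF g(1) _ z]) (rule g(2))
    have "lower_op b u z = c * (cnj z / rho z) * (z ^ (b + 2) * g (1 / z)) -
        (c * z ^ (b + 2) / z * g (1 / z) - z ^ (b + 2) / z ^ 2 * dz g (1 / z))"
      unfolding lower_op_def D g(2)[OF z] c_def by simp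
    also have "\<dots> = z ^ b * (c * z * g (1 / z) * ((cnj z * z) / rho z - 1) + dz g (1 / z))"
      using z by (simp add: algebra_simps power2_eq_square)
    also have "(cnj z * z) / rho z - 1 = - 1 / rho z"
      unfolding 1 by (simp add: field_simps)
    also have "z ^ b * (c * z * g (1 / z) * (- 1 / rho z) + dz g (1 / z)) = z ^ b * - lower_op b g (1 / z)"
      unfolding 3 by (simp add: algebra_simps)
    finally show ?thesis .
  qed
  then show ?thesis
    unfolding forms_0_iff
    by (intro conjI exI[of _ "\<lambda>z. - lower_op b g z"] lower_op_smooth u smooth_minus g) auto
qed

text \<open>rho^2 times the antiholomorphic derivative of cnj z / rho is 1, which is how the
  constant curvature enters. The mixed second derivatives cancel by \<open>dbar_dz_commute\<close>,
  and differentiating rho^2 in \<open>raise_op\<close> accounts for the change of connection weight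
  from b + 2 to b + 4.\<close>

lemma raise_lower_commute:
  assumes u: "smooth u"
  shows "raise_op (lower_op b u) z = lower_op (b + 2) (raise_op u) z + of_nat (b + 2) * u z"
proof -
  define c where "c = (of_nat (b + 2) :: complex)"
  note wu = smooth_has_wirt[OF u, of z]
  have "has_wirt (\<lambda>z. (c * cnj z) * (1 / rho z ^ 1) * u z - dz u z)
    (((0 * cnj z + c * cnj 0) * (1 / rho z ^ 1) + (c * cnj z) * (- of_nat 1 / rho z ^ (1 + 1) * cnj z)) * u z
       + (c * cnj z) * (1 / rho z ^ 1) * dz u z - dz (dz u) z)
    (((0 * cnj z + c * cnj 1) * (1 / rho z ^ 1) + (c * cnj z) * (- of_nat 1 / rho z ^ (1 + 1) * z)) * u z
       + (c * cnj z) * (1 / rho z ^ 1) * dbar 0 u z - dbar 0 (dz u) z) z"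
    by (intro has_wirt_diff has_wirt_mult has_wirt_inverse_rho_power has_wirt_const has_wirt_cnj wu
        smooth_has_wirt[OF smooth_dz[OF u]] has_wirt_field DERIV_ident)
  from has_wirt_dbar[OF this]
  have 1: "dbar 0 (lower_op b u) z = (c / rho z - c * (z * cnj z) / rho z ^ 2) * u z
       + c * cnj z / rho z * dbar 0 u z - dbar 0 (dz u) z"
    unfolding lower_op_def c_def[symmetric] by (simp add: power2_eq_square mult_ac)
  have "c / rho z - c * (z * cnj z) / rho z ^ 2 = c * (rho z - z * cnj z) / rho z ^ 2"
    by (simp add: field_simps power2_eq_square)
  also have "rho z - z * cnj z = 1" by (simp add: rho_def)
  finally have eq: "c / rho z - c * (z * cnj z) / rho z ^ 2 = c * 1 / rho z ^ 2" .
  have L: "raise_op (lower_op b u) z = c * u z + c * cnj z * rho z * dbar 0 u z - rho z ^ 2 * dbar 0 (dz u) z"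
    unfolding raise_op_def 1 eq by (simp add: field_simps power2_eq_square)
  have "has_wirt (\<lambda>z. rho z * rho z * dbar 0 u z)
     ((cnj z * rho z + rho z * cnj z) * dbar 0 u z + rho z * rho z * dz (dbar 0 u) z)
     ((z * rho z + rho z * z) * dbar 0 u z + rho z * rho z * dbar 0 (dbar 0 u) z) z"
    by (intro has_wirt_mult has_wirt_rho smooth_has_wirt[OF smooth_dbar[OF u]])
  from has_wirt_dz[OF this]
  have 2: "dz (raise_op u) z = 2 * (cnj z * rho z * dbar 0 u z) + rho z ^ 2 * dz (dbar 0 u) z"
    unfolding raise_op_def by (simp add: power2_eq_square algebra_simps)
  have "of_nat (b + 2 + 2) = c + 2" by (simp add: c_def)
  then have "lower_op (b + 2) (raise_op u) z = (c + 2) * cnj z * rho z * dbar 0 u z - dz (raise_op u) z"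
    unfolding lower_op_def raise_op_def by (simp add: power2_eq_square)
  then show ?thesis
    unfolding L 2 dbar_dz_commute[OF u] c_def[symmetric] by (simp add: algebra_simps)
qed

lemma raise_op_scale: "smooth u \<Longrightarrow> raise_op (fun_scale c u) = fun_scale c (raise_op u)"
  using has_wirt_dbar[OF has_wirt_mult[OF has_wirt_const[of c] smooth_has_wirt]]
  by (auto simp: raise_op_def fun_eq_iff fun_scale_def algebra_simps)

lemma lower_op_add: "smooth u \<Longrightarrow> smooth v \<Longrightarrow> lower_op b (u + v) = lower_op b u + lower_op b v"
  using has_wirt_dz[OF has_wirt_add[OF smooth_has_wirt smooth_has_wirt]]
  by (auto simp: lower_op_def fun_eq_iff plus_fun_def algebra_simps add_divide_distrib)

lemma lower_op_scale: "smooth u \<Longrightarrow> lower_op b (fun_scale c u) = fun_scale c (lower_op b u)"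
  using has_wirt_dz[OF has_wirt_mult[OF has_wirt_const[of c] smooth_has_wirt]]
  by (auto simp: lower_op_def fun_eq_iff fun_scale_def algebra_simps)

lemma forms_0_subspace: "cfun.subspace (forms b 0)"
proof (rule cfun.subspaceI)
  show "0 \<in> forms b 0"
    unfolding forms_0_iff zero_fun_def by (intro conjI exI[of _ "\<lambda>_. 0"] smooth_const) auto
next
  fix u v assume "u \<in> forms b 0" "v \<in> forms b 0"
  then obtain g h where "smooth u" "smooth v" "smooth g" "smooth h"
    "\<And>z. z \<noteq> 0 \<Longrightarrow> u z = z ^ b * g (1 / z)" "\<And>z. z \<noteq> 0 \<Longrightarrow> v z = z ^ b * h (1 / z)"
    by (auto simp: forms_0_iff)
  then show "u + v \<in> forms b 0"
    unfolding forms_0_iff plus_fun_def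
    by (intro conjI exI[of _ "\<lambda>z. g z + h z"] smooth_add) (auto simp: algebra_simps)
next
  fix c u assume "u \<in> forms b 0"
  then obtain g where "smooth u" "smooth g" "\<And>z. z \<noteq> 0 \<Longrightarrow> u z = z ^ b * g (1 / z)"
    by (auto simp: forms_0_iff)
  then show "fun_scale c u \<in> forms b 0"
    unfolding forms_0_iff fun_scale_def
    by (intro conjI exI[of _ "\<lambda>z. c * g z"] smooth_mult smooth_const) (auto simp: algebra_simps)
qed

section \<open>The L2 inner product on sections and the adjointness of the two operators\<close>

lemma mult_cnj_cmod: "w * cnj w = (of_real (cmod w))\<^sup>2"
  using complex_norm_square[of w] by simp

text \<open>The pointwise Hermitian product of two sections is continuous on the compact projective
  line; here the unit disc of each chart supplies one bound.\<close>

lemma sections_product_bounded: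
  assumes "f \<in> forms b 0" "g \<in> forms b 0"
  obtains K where "K \<ge> 0" "\<And>z. cmod (f z * cnj (g z)) \<le> K * (1 + (cmod z)\<^sup>2) ^ b"
proof -
  from assms(1) obtain p where f: "smooth f" and p: "smooth p" "\<And>z. z \<noteq> 0 \<Longrightarrow> f z = z ^ b * p (1 / z)"
    unfolding forms_0_iff by auto
  from assms(2) obtain q where g: "smooth g" and q: "smooth q" "\<And>z. z \<noteq> 0 \<Longrightarrow> g z = z ^ b * q (1 / z)"
    unfolding forms_0_iff by auto
  have "smooth (\<lambda>z. f z * cnj (g z))" "smooth (\<lambda>z. p z * cnj (q z))"
    by (intro smooth_mult smooth_cnj f g p q)+
  note cont = this[THEN smooth_continuous_on]
  obtain A where A: "A \<ge> 0" "\<And>z. cmod z \<le> 1 \<Longrightarrow> cmod (f z * cnj (g z)) \<le> A"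
    using bounded_continuous_unit_disc[OF cont(1)] by metis
  obtain B where B: "B \<ge> 0" "\<And>z. cmod z \<le> 1 \<Longrightarrow> cmod (p z * cnj (q z)) \<le> B"
    using bounded_continuous_unit_disc[OF cont(2)] by metis
  have "cmod (f z * cnj (g z)) \<le> (A + B) * (1 + (cmod z)\<^sup>2) ^ b" for z
  proof (cases "cmod z \<le> 1")
    case True
    have "1 \<le> (1 + (cmod z)\<^sup>2) ^ b" by (intro one_le_power) auto
    then show ?thesis
      using mult_mono[of "cmod (f z * cnj (g z))" "A + B" 1 "(1 + (cmod z)\<^sup>2) ^ b"] A(2)[OF True] A(1) B(1)
      by simp
  next
    case False
    then have z: "z \<noteq> 0" "cmod (1 / z) \<le> 1" by (auto simp: norm_divide divide_le_eq)
    have "cmod (f z * cnj (g z)) = cmod (p (1 / z) * cnj (q (1 / z))) * ((cmod z)\<^sup>2) ^ b"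
      by (simp add: p(2)[OF z(1)] q(2)[OF z(1)] norm_mult norm_power power2_eq_square power_mult_distrib)
    also have "\<dots> \<le> (A + B) * (1 + (cmod z)\<^sup>2) ^ b"
      using B(2)[OF z(2)] A(1) B(1) by (intro mult_mono power_mono) auto
    finally show ?thesis .
  qed
  then show ?thesis using A(1) B(1) that[of "A + B"] by simp
qed

lemma sec_inner_integrable:
  assumes "f \<in> forms b 0" "g \<in> forms b 0"
  shows "integrable lborel (\<lambda>z. f z * cnj (g z) / (of_real pi * rho z ^ (b + 2)))"
proof -
  obtain K where K: "K \<ge> 0" "\<And>z. cmod (f z * cnj (g z)) \<le> K * (1 + (cmod z)\<^sup>2) ^ b"
    by (rule sections_product_bounded[OF assms]) blast
  have "smooth (\<lambda>z. f z * cnj (g z) / (of_real pi * rho z ^ (b + 2)))"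
    using forms_0_smooth[OF assms(1)] forms_0_smooth[OF assms(2)]
    by (intro smooth_divide smooth_mult smooth_cnj smooth_power smooth_rho smooth_const) auto
  note cont = smooth_continuous_on[OF this]
  show ?thesis
  proof (rule integrable_decay_bound[OF cont])
    fix z
    let ?r = "1 + (cmod z)\<^sup>2"
    have r: "?r > 0" by (simp add: add_pos_nonneg)
    \<comment> \<open>Expanding gives (1 + |z|)^2 \<le> 2 (1 + |z|^2), whose square compares the
      volume density with (1 + |z|)^-4; the weaker exponent -3 is the one in
      \<open>decay_prod_ge\<close>.\<close>
    have "0 \<le> (1 - cmod z)\<^sup>2" by simp
    then have "(1 + cmod z)\<^sup>2 \<le> 2 * ?r" by (simp add: power2_eq_square algebra_simps)
    then have "((1 + cmod z)\<^sup>2)\<^sup>2 \<le> (2 * ?r)\<^sup>2" by (intro power_mono) auto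
    also have "(2 * ?r)\<^sup>2 = 4 * ?r ^ 2" by (simp only: power_mult_distrib) simp
    also have "((1 + cmod z)\<^sup>2)\<^sup>2 = (1 + cmod z) ^ 4" by (simp flip: power_mult)
    finally have "(1 + cmod z) ^ 4 \<le> 4 * ?r ^ 2" .
    moreover have "(1 + cmod z) ^ 3 \<le> (1 + cmod z) ^ 4" by (intro power_increasing) auto
    ultimately have "(1 + cmod z) ^ 3 \<le> 4 * ?r ^ 2" by (rule order_trans[rotated])
    moreover have "?r ^ 2 > 0" "(1 + cmod z) ^ 3 > 0"
      using r by (auto intro: add_pos_nonneg)
    ultimately have "1 / ?r ^ 2 \<le> 4 * (1 / (1 + cmod z) ^ 3)"
      by (simp add: divide_simps mult_ac)
    have "cmod (f z * cnj (g z) / (of_real pi * rho z ^ (b + 2))) = cmod (f z * cnj (g z)) / (pi * ?r ^ (b + 2))"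
      by (simp only: norm_divide norm_mult norm_power cmod_rho norm_of_real abs_of_nonneg[OF pi_ge_zero])
    also have "\<dots> \<le> K * ?r ^ b / (pi * ?r ^ (b + 2))"
      using r by (intro divide_right_mono K(2)) auto
    also have "\<dots> = K / pi * (1 / ?r ^ 2)"
      using r by (simp add: power_add power2_eq_square)
    also have "\<dots> \<le> K / pi * (4 * (decay (Re z) * decay (Im z)))"
      using \<open>1 / ?r ^ 2 \<le> _\<close> decay_prod_ge[of z] K(1) by (intro mult_left_mono) auto
    finally show "cmod (f z * cnj (g z) / (of_real pi * rho z ^ (b + 2))) \<le>
        (4 * K / pi) * (decay (Re z) * decay (Im z))" by (simp add: mult_ac)
  qed
qed

lemma sec_inner_scale_right: "sec_inner b f (fun_scale c g) = cnj c * sec_inner b f g"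
proof -
  have "sec_inner b f (fun_scale c g) = (LINT z|lborel. cnj c * (f z * cnj (g z) / (of_real pi * rho z ^ (b + 2))))"
    unfolding sec_inner_def by (intro Bochner_Integration.integral_cong) (auto simp: fun_scale_def)
  also have "\<dots> = cnj c * sec_inner b f g"
    unfolding sec_inner_def by (rule integral_mult_right_zero)
  finally show ?thesis .
qed

lemma sec_inner_diff_right:
  assumes "f \<in> forms b 0" "g \<in> forms b 0" "h \<in> forms b 0"
  shows "sec_inner b f (g - h) = sec_inner b f g - sec_inner b f h"
  using sec_inner_integrable[OF assms(1,2)] sec_inner_integrable[OF assms(1,3)]
  by (simp add: sec_inner_def fun_diff_def algebra_simps diff_divide_distrib)

lemma sec_inner_self:
  "sec_inner b f f = of_real (LINT z|lborel. (cmod (f z))\<^sup>2 / (pi * (1 + (cmod z)\<^sup>2) ^ (b + 2)))"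
  unfolding sec_inner_def integral_complex_of_real[symmetric] rho_of_real
  by (intro Bochner_Integration.integral_cong) (simp_all add: mult_cnj_cmod)

lemma sec_inner_self_nonneg: "\<exists>r\<ge>0. sec_inner b f f = of_real r"
  unfolding sec_inner_self by (intro exI conjI refl integral_nonneg_AE AE_I2) auto

text \<open>The set where f is nonzero is open, and vanishing of the integral makes it null; a
  nonempty open set is not null.\<close>

lemma sec_inner_self_eq_0:
  assumes f: "f \<in> forms b 0" and 0: "sec_inner b f f = 0"
  shows "f = 0"
proof (rule ccontr)
  assume "f \<noteq> 0"
  then obtain z0 where z0: "f z0 \<noteq> 0" by (auto simp: fun_eq_iff)
  let ?h = "\<lambda>z. (cmod (f z))\<^sup>2 / (pi * (1 + (cmod z)\<^sup>2) ^ (b + 2))"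
  have "integrable lborel (\<lambda>z. complex_of_real (?h z))"
    using sec_inner_integrable[OF f f]
    by (rule Bochner_Integration.integrable_cong[THEN iffD1, rotated 2])
       (simp_all add: rho_of_real mult_cnj_cmod)
  then have int: "integrable lborel ?h"
    by (simp only: complex_of_real_integrable_eq)
  have pos: "1 + (cmod z)\<^sup>2 \<noteq> 0" for z by (simp add: add_nonneg_eq_0_iff)
  have "integral\<^sup>L lborel ?h = 0"
    using 0 unfolding sec_inner_self of_real_eq_0_iff .
  then have "AE z in lborel. ?h z = 0"
    by (subst integral_nonneg_eq_0_iff_AE[OF int, symmetric]) auto
  then have ae: "AE z in lborel. z \<notin> {z. f z \<noteq> 0}"
    by eventually_elim (use pos in auto)
  have op: "open {z. f z \<noteq> 0}"
    by (intro open_Collect_neq smooth_continuous_on[OF forms_0_smooth[OF f]] continuous_on_const)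
  have "{z. f z \<noteq> 0} \<in> null_sets lborel"
    using ae op by (subst AE_iff_null_sets) auto
  then have "negligible {z. f z \<noteq> 0}"
    by (simp add: negligible_iff_null_sets null_sets_completionI)
  then show False
    using open_not_negligible[OF op] z0 by auto
qed

text \<open>F pairs v with the conjugate of u so that F dz is a (1,0)-form on the whole line. Its
  antiholomorphic derivative, divided by pi, is exactly the difference of the two integrands, so
  Stokes' theorem applies.\<close>

lemma raise_lower_adjoint:
  assumes v: "v \<in> forms b 0" and u: "u \<in> forms (b + 2) 0"
  shows "sec_inner (b + 2) (raise_op v) u = sec_inner b v (lower_op b u)"
proof -
  from v obtain p where sv: "smooth v" and p: "smooth p" "\<And>z. z \<noteq> 0 \<Longrightarrow> v z = z ^ b * p (1 / z)"
    unfolding forms_0_iff by auto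
  from u obtain q where su: "smooth u" and q: "smooth q" "\<And>z. z \<noteq> 0 \<Longrightarrow> u z = z ^ (b + 2) * q (1 / z)"
    unfolding forms_0_iff by auto
  define F where "F = (\<lambda>z. v z * cnj (u z) * (1 / rho z ^ (b + 2)))"
  define G where "G = (\<lambda>z. p z * cnj (q z) * (1 / rho z ^ (b + 2)))"
  have sF: "smooth F" and sG: "smooth G"
    unfolding F_def G_def by (intro smooth_mult smooth_cnj smooth_divide smooth_power smooth_rho smooth_const sv su p q; simp)+
  have FG: "F z = G (1 / z) / z ^ 2" if "z \<noteq> 0" for z
    using that by (simp add: F_def G_def p(2) q(2) rho_inverse power_divide power_mult_distrib field_simps power2_eq_square)
  define c where "c = (of_nat (b + 2) :: complex)"
  have "cnj c = c" by (simp add: c_def)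
  have dF: "dbar 0 F z = (dbar 0 v z * cnj (u z) + v z * cnj (dz u z)) * (1 / rho z ^ (b + 2))
      + v z * cnj (u z) * (- c / rho z ^ (b + 2 + 1) * z)" for z
    unfolding F_def c_def
    by (rule has_wirt_dbar[OF has_wirt_mult[OF has_wirt_mult[OF smooth_has_wirt[OF sv] has_wirt_cnj[OF smooth_has_wirt[OF su]]]
          has_wirt_inverse_rho_power]])
  have eq: "raise_op v z * cnj (u z) / (of_real pi * rho z ^ (b + 2 + 2))
       - v z * cnj (lower_op b u z) / (of_real pi * rho z ^ (b + 2)) = dbar 0 F z / of_real pi" for z
    unfolding dF raise_op_def lower_op_def c_def[symmetric]
    using \<open>cnj c = c\<close> by (simp add: c_def[symmetric] power_add field_simps power2_eq_square)
  have "sec_inner (b + 2) (raise_op v) u - sec_inner b v (lower_op b u) = (LINT z|lborel. dbar 0 F z / of_real pi)"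
    unfolding sec_inner_def eq[symmetric]
    by (rule Bochner_Integration.integral_diff[symmetric])
       (rule sec_inner_integrable raise_op_section lower_op_section u v)+
  also have "\<dots> = 0"
    using weight_two_integral_dbar[OF sF sG FG] by simp
  finally show ?thesis by simp
qed

section \<open>The formal adjoint and the Laplacian on (0,1)-forms\<close>

lemma l2_inner_0: "l2_inner b 0 f g = sec_inner b f g"
  unfolding l2_inner_def sec_inner_def
  by (intro Bochner_Integration.integral_cong)
     (simp_all add: fs_metric_def fs_volume_def rho_of_real power_add power2_eq_square)

lemma l2_inner_1: "l2_inner b 1 f g = sec_inner (b + 2) (\<lambda>z. rho z ^ 2 * f z) (\<lambda>z. rho z ^ 2 * g z)"
proof -
  have "f z * cnj (g z) * of_real (fs_metric b 1 z) * of_real (fs_volume z) =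
      rho z ^ 2 * f z * cnj (rho z ^ 2 * g z) / (of_real pi * rho z ^ (b + 2 + 2))" for z
  proof -
    have "complex_of_real (fs_metric b 1 z) = rho z ^ 2 / rho z ^ b"
         "complex_of_real (fs_volume z) = 1 / (of_real pi * rho z ^ 2)"
      by (simp_all add: fs_metric_def fs_volume_def rho_of_real)
    then show ?thesis by (simp add: field_simps eval_nat_numeral)
  qed
  then show ?thesis unfolding l2_inner_def sec_inner_def by simp
qed

lemma l2_inner_dbar: "l2_inner b (Suc 0) (dbar 0 v) f = sec_inner (b + 2) (raise_op v) (\<lambda>z. rho z ^ 2 * f z)"
  using l2_inner_1[of b "dbar 0 v" f] by (simp add: raise_op_def)

text \<open>Existence is \<open>raise_lower_adjoint\<close>. For uniqueness, the difference of two
  candidates serves as test form, which makes its own norm vanish.\<close>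

lemma dbar_adj_0:
  assumes f: "f \<in> forms b 1"
  shows "dbar_adj b 0 f = lower_op b (\<lambda>z. rho z ^ 2 * f z)"
  unfolding dbar_adj_def
proof (rule the_equality)
  let ?u = "\<lambda>z. rho z ^ 2 * f z"
  have u: "?u \<in> forms (b + 2) 0" using f by (simp only: form_1_section_iff)
  have adj: "l2_inner b (Suc 0) (dbar 0 v) f = l2_inner b 0 v (lower_op b ?u)" if "v \<in> forms b 0" for v
    unfolding l2_inner_dbar l2_inner_0 by (rule raise_lower_adjoint[OF that u])
  then show "lower_op b ?u \<in> forms b 0 \<and>
      (\<forall>v\<in>forms b 0. l2_inner b (Suc 0) (dbar 0 v) f = l2_inner b 0 v (lower_op b ?u))"
    using lower_op_section[OF u] by blast
  fix w
  assume w: "w \<in> forms b 0 \<and> (\<forall>v\<in>forms b 0. l2_inner b (Suc 0) (dbar 0 v) f = l2_inner b 0 v w)"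
  let ?d = "w - lower_op b ?u"
  have d: "?d \<in> forms b 0"
    using w lower_op_section[OF u] cfun.subspace_diff[OF forms_0_subspace] by blast
  have "sec_inner b ?d ?d = 0"
    using w adj[OF d] d lower_op_section[OF u] by (simp add: sec_inner_diff_right l2_inner_0)
  then have "?d = 0" by (rule sec_inner_self_eq_0[OF d])
  then show "w = lower_op b ?u" by simp
qed

text \<open>In the Laplacian this adjoint is applied only to \<open>dbar 1 f\<close>, which is 0.
  Testing a candidate against itself shows that it vanishes.\<close>

lemma dbar_adj_1_zero: "dbar_adj b 1 0 = 0"
  unfolding dbar_adj_def
proof (rule the_equality)
  have z: "l2_inner b q f 0 = 0" for q f
    by (simp add: l2_inner_def)
  have z': "l2_inner b (Suc 1) (dbar 1 f) 0 = l2_inner b 1 f 0" for f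
    by (simp only: z)
  have "(0 :: complex \<Rightarrow> complex) \<in> forms b 1"
    unfolding forms_1_iff zero_fun_def by (intro conjI exI[of _ "\<lambda>_. 0"] smooth_const) auto
  then show "0 \<in> forms b 1 \<and> (\<forall>v\<in>forms b 1. l2_inner b (Suc 1) (dbar 1 v) 0 = l2_inner b 1 v 0)"
    using z' by blast
  fix w assume w: "w \<in> forms b 1 \<and> (\<forall>v\<in>forms b 1. l2_inner b (Suc 1) (dbar 1 v) 0 = l2_inner b 1 v w)"
  then have "l2_inner b 1 w w = 0" using z by metis
  then have "(\<lambda>z. rho z ^ 2 * w z) = 0"
    using w unfolding l2_inner_1 form_1_section_iff by (intro sec_inner_self_eq_0) auto
  then show "w = 0" by (simp add: fun_eq_iff)
qed

lemma laplacian_1: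
  assumes "f \<in> forms b 1"
  shows "laplacian b 1 f = dbar 0 (lower_op b (\<lambda>z. rho z ^ 2 * f z))"
  using dbar_adj_0[OF assms] dbar_adj_1_zero[of b]
  by (simp add: laplacian_def dbar_def[of "Suc 0"])

section \<open>The spectrum of the Laplacian\<close>

definition raise_eigenspace :: "nat \<Rightarrow> complex \<Rightarrow> (complex \<Rightarrow> complex) set" where
  "raise_eigenspace b \<nu> = {u \<in> forms b 0. lower_op b (raise_op u) = fun_scale \<nu> u}"

text \<open>The value of \<open>cfun.dim\<close> alone does not exhibit a finite basis; this
  predicate does, so the dimension can be transported along injective maps.\<close>

definition has_dim :: "(complex \<Rightarrow> complex) set \<Rightarrow> nat \<Rightarrow> bool" where
  "has_dim V n \<longleftrightarrow> (\<exists>B. finite B \<and> cfun.independent B \<and> cfun.span B = V \<and> card B = n)"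

lemma has_dim_dim: "has_dim V n \<Longrightarrow> cfun.dim V = n"
  unfolding has_dim_def by (metis cfun.dim_eq_card_independent cfun.dim_span)

text \<open>Differential operators are additive only on differentiable functions, so L need not be
  linear on the whole function space. A globally linear g is built from the values of L on a basis
  and agrees with L on V.\<close>

lemma has_dim_image:
  assumes V: "has_dim V n"
    and add: "\<And>u v. u \<in> V \<Longrightarrow> v \<in> V \<Longrightarrow> L (u + v) = L u + L v"
    and scale: "\<And>c u. u \<in> V \<Longrightarrow> L (fun_scale c u) = fun_scale c (L u)"
    and inj: "\<And>u. u \<in> V \<Longrightarrow> L u = 0 \<Longrightarrow> u = 0"
  shows "has_dim (L ` V) n"
proof -
  interpret P: vector_space_pair fun_scale fun_scale by unfold_locales
  obtain B where B: "finite B" "cfun.independent B" "cfun.span B = V" "card B = n"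
    using V by (auto simp: has_dim_def)
  obtain g where g: "Vector_Spaces.linear fun_scale fun_scale g" "\<forall>x\<in>B. g x = L x"
    using P.linear_independent_extend[OF B(2)] by blast
  interpret g: Vector_Spaces.linear fun_scale fun_scale g by fact
  have sub: "cfun.subspace V" unfolding B(3)[symmetric] by (rule cfun.subspace_span)
  have zero: "L 0 = 0"
  proof -
    have "L (fun_scale 0 0) = fun_scale 0 (L 0)"
      by (rule scale) (rule cfun.subspace_0[OF sub])
    then show ?thesis by (simp add: cfun.scale_zero_left)
  qed
  have gL: "g u = L u" if "u \<in> V" for u
  proof -
    have "cfun.subspace {u \<in> V. g u = L u}"
      by (rule cfun.subspaceI)
         (use sub in \<open>auto simp: g.zero zero g.add g.scale add scale cfun.subspace_0 cfun.subspace_add cfun.subspace_scale\<close>)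
    moreover have "B \<subseteq> {u \<in> V. g u = L u}"
      using g(2) cfun.span_superset[of B] B(3) by auto
    ultimately have "cfun.span B \<subseteq> {u \<in> V. g u = L u}"
      by (rule cfun.span_minimal[rotated])
    then show ?thesis using that B(3) by auto
  qed
  have inj_g: "inj_on g (cfun.span B)"
    unfolding g.inj_on_iff_eq_0[OF cfun.subspace_span]
    using gL inj B(3) by auto
  have "cfun.independent (g ` B)"
    by (rule g.independent_injective_image[OF B(2) inj_g])
  moreover have "cfun.span (g ` B) = L ` V"
    using gL unfolding g.span_image B(3) by (auto simp: image_def)
  moreover have "card (g ` B) = n"
    using card_image[OF inj_on_subset[OF inj_g cfun.span_superset]] B(4) by simp
  ultimately show ?thesis
    unfolding has_dim_def using B(1) by blast
qed

lemma sum_fun_apply: "(\<Sum>x\<in>A. f x) z = (\<Sum>x\<in>A. (f x z :: complex))" for f :: "'i \<Rightarrow> complex \<Rightarrow> complex"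
  by (induction A rule: infinite_finite_induct) auto

lemma has_dim_polynomials:
  "has_dim {u. \<exists>c. u = (\<lambda>z. \<Sum>i\<le>b. c i * z ^ i)} (b + 1)"
proof -
  define p :: "nat \<Rightarrow> complex \<Rightarrow> complex" where "p i = (\<lambda>z. z ^ i)" for i
  have inj: "inj_on p A" for A
  proof (rule inj_onI)
    fix i j assume "p i = p j"
    \<comment> \<open>Evaluation at 2 separates the monomials.\<close>
    then have "p i 2 = p j 2" by simp
    then have "cmod (2 ^ i) = cmod (2 ^ j)" by (simp add: p_def)
    then have "(2::real) ^ i = 2 ^ j" by (simp add: norm_power)
    then show "i = j" by simp
  qed
  have comb: "(\<Sum>v\<in>p ` {..b}. fun_scale (c v) v) = (\<lambda>z. \<Sum>i\<le>b. c (p i) * z ^ i)" for c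
    by (subst sum.reindex[OF inj]) (auto simp: fun_eq_iff sum_fun_apply fun_scale_def p_def)
  have "cfun.independent (p ` {..b})"
  proof (rule cfun.independent_if_scalars_zero)
    fix c v assume 0: "(\<Sum>x\<in>p ` {..b}. fun_scale (c x) x) = 0" and v: "v \<in> p ` {..b}"
    then have "\<forall>z. (\<Sum>i\<le>b. c (p i) * z ^ i) = 0"
      unfolding comb by (simp add: fun_eq_iff)
    then show "c v = 0" using v polyfun_eq_0[of "\<lambda>i. c (p i)" b] by auto
  qed simp
  moreover have "cfun.span (p ` {..b}) = {u. \<exists>c. u = (\<lambda>z. \<Sum>i\<le>b. c i * z ^ i)}"
  proof -
    \<comment> \<open>Coefficients in a span are indexed by the basis functions; the inverse of
      \<open>p\<close> converts a coefficient sequence to that form.\<close>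
    have "(\<lambda>z. \<Sum>i\<le>b. c i * z ^ i) \<in> range (\<lambda>c. \<Sum>v\<in>p ` {..b}. fun_scale (c v) v)" for c
      using comb[of "\<lambda>v. c (the_inv_into {..b} p v)"]
      by (intro range_eqI[of _ _ "\<lambda>v. c (the_inv_into {..b} p v)"])
         (auto simp: the_inv_into_f_f[OF inj] fun_eq_iff intro!: sum.cong)
    then show ?thesis
      by (subst cfun.span_finite) (auto simp: comb)
  qed
  moreover have "card (p ` {..b}) = b + 1"
    by (simp add: card_image[OF inj])
  ultimately show ?thesis unfolding has_dim_def by blast
qed

section \<open>Eigenvalues and multiplicities on sections\<close>

lemma raise_op_inner:
  assumes "u \<in> raise_eigenspace b \<nu>"
  shows "sec_inner (b + 2) (raise_op u) (raise_op u) = cnj \<nu> * sec_inner b u u"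
  using assms raise_lower_adjoint[of u b "raise_op u"] raise_op_section[of u b]
  by (simp add: raise_eigenspace_def sec_inner_scale_right)

lemma raise_eigenspace_0_iff: "u \<in> raise_eigenspace b 0 \<longleftrightarrow> u \<in> forms b 0 \<and> raise_op u = 0"
proof
  assume u: "u \<in> raise_eigenspace b 0"
  then have "u \<in> forms b 0" by (simp add: raise_eigenspace_def)
  with sec_inner_self_eq_0[OF raise_op_section] raise_op_inner[OF u]
  show "u \<in> forms b 0 \<and> raise_op u = 0" by simp
next
  have "lower_op b 0 = fun_scale 0 u" for b u
    using lower_op_scale[OF smooth_const[of 0], of b 0]
    by (simp add: fun_scale_def zero_fun_def)
  then show "u \<in> forms b 0 \<and> raise_op u = 0 \<Longrightarrow> u \<in> raise_eigenspace b 0"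
    by (simp add: raise_eigenspace_def)
qed

lemma raise_eigenvalue_nonneg:
  assumes u: "u \<in> raise_eigenspace b \<nu>" and nz: "u \<noteq> 0"
  obtains r where "r \<ge> 0" "\<nu> = of_real r"
proof -
  obtain x where x: "x \<ge> 0" "sec_inner b u u = of_real x"
    using sec_inner_self_nonneg by blast
  obtain y where y: "y \<ge> 0" "sec_inner (b + 2) (raise_op u) (raise_op u) = of_real y"
    using sec_inner_self_nonneg by blast
  have "x \<noteq> 0"
    using sec_inner_self_eq_0[of u b] u nz x by (auto simp: raise_eigenspace_def)
  have "cnj \<nu> = of_real (y / x)"
    using raise_op_inner[OF u] x y \<open>x \<noteq> 0\<close> by (simp add: field_simps)
  then have "\<nu> = of_real (y / x)" by (metis complex_cnj_cnj complex_cnj_complex_of_real)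
  then show ?thesis using x(1) y(1) by (intro that[of "y / x"]) auto
qed

text \<open>These are the holomorphic sections. In the kernel u is entire, the w-chart bounds it by
  a multiple of |z|^b outside the unit disc, and Liouville's theorem applies. Conversely, the
  w-coefficient of a polynomial is the polynomial with reversed coefficients.\<close>

lemma raise_eigenspace_0: "raise_eigenspace b 0 = {u. \<exists>c. u = (\<lambda>z. \<Sum>i\<le>b. c i * z ^ i)}"
proof (intro set_eqI iffI)
  fix u assume "u \<in> raise_eigenspace b 0"
  then have u: "u \<in> forms b 0" and "raise_op u = 0" by (simp_all add: raise_eigenspace_0_iff)
  then have d: "dbar 0 u z = 0" for z by (auto simp: raise_op_def fun_eq_iff)
  from u obtain g where su: "smooth u" and g: "smooth g" "\<And>z. z \<noteq> 0 \<Longrightarrow> u z = z ^ b * g (1 / z)"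
    unfolding forms_0_iff by auto
  have "(u has_field_derivative dz u z) (at z)" for z
    using smooth_has_wirt[OF su, of z] by (simp add: d has_wirt_def has_field_derivative_def)
  then have hol: "u holomorphic_on UNIV"
    using holomorphic_on_open by blast
  obtain K where K: "K \<ge> 0" "\<And>z. cmod z \<le> 1 \<Longrightarrow> cmod (g z) \<le> K"
    using bounded_continuous_unit_disc[OF smooth_continuous_on[OF g(1)]] by metis
  have "u z = (\<Sum>k\<le>b. (deriv ^^ k) u 0 / fact k * z ^ k)" for z
  proof (rule Liouville_polynomial[OF hol])
    fix z :: complex assume z: "1 \<le> cmod z"
    then have "z \<noteq> 0" "cmod (1 / z) \<le> 1" by (auto simp: norm_divide divide_le_eq)
    then have "cmod (u z) = cmod z ^ b * cmod (g (1 / z))"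
      by (simp add: g(2) norm_mult norm_power)
    also have "\<dots> \<le> cmod z ^ b * K" by (intro mult_left_mono K(2)) (use \<open>cmod (1 / z) \<le> 1\<close> in auto)
    finally show "cmod (u z) \<le> K * cmod z ^ b" by (simp add: mult.commute)
  qed
  then have "u = (\<lambda>z. \<Sum>i\<le>b. ((deriv ^^ i) u 0 / fact i) * z ^ i)" by auto
  then show "u \<in> {u. \<exists>c. u = (\<lambda>z. \<Sum>i\<le>b. c i * z ^ i)}"
    by (intro CollectI exI[of _ "\<lambda>i. (deriv ^^ i) u 0 / fact i"])
next
  fix u :: "complex \<Rightarrow> complex" assume "u \<in> {u. \<exists>c. u = (\<lambda>z. \<Sum>i\<le>b. c i * z ^ i)}"
  then obtain c where u: "u = (\<lambda>z. \<Sum>i\<le>b. c i * z ^ i)" by blast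
  have sum: "smooth (\<lambda>z. \<Sum>i\<in>A. c i * z ^ e i)" for A c and e :: "nat \<Rightarrow> nat"
    by (induction A rule: infinite_finite_induct)
      (auto intro!: smooth_add smooth_mult smooth_power smooth_const smooth_id)
  have "u z = z ^ b * (\<Sum>i\<le>b. c i * (1 / z) ^ (b - i))" if "z \<noteq> 0" for z
    unfolding u sum_distrib_left
    by (intro sum.cong) (use that in \<open>auto simp: power_diff power_divide field_simps\<close>)
  then have mem: "u \<in> forms b 0"
    unfolding forms_0_iff using sum[where c = c and A = "{..b}" and e = "\<lambda>i. i"] sum[where c = c and A = "{..b}" and e = "\<lambda>i. b - i"] u by blast
  have "(u has_field_derivative deriv u z) (at z)" for z
    unfolding u by (intro DERIV_deriv_iff_field_differentiable[THEN iffD2] derivative_intros field_differentiable_power)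
  from has_wirt_dbar[OF has_wirt_field[OF this]] have "raise_op u = 0"
    by (simp add: raise_op_def fun_eq_iff)
  with mem show "u \<in> raise_eigenspace b 0" by (simp add: raise_eigenspace_0_iff)
qed

lemma raise_op_eigen:
  assumes u: "u \<in> raise_eigenspace b \<nu>"
  shows "raise_op u \<in> raise_eigenspace (b + 2) (\<nu> - of_nat (b + 2))"
proof -
  have f: "u \<in> forms b 0" and e: "lower_op b (raise_op u) = fun_scale \<nu> u"
    using u by (auto simp: raise_eigenspace_def)
  note sm = forms_0_smooth[OF f]
  have "lower_op (b + 2) (raise_op (raise_op u)) z = fun_scale (\<nu> - of_nat (b + 2)) (raise_op u) z" for z
    using raise_lower_commute[OF raise_op_smooth[OF sm], of b z]
    unfolding e raise_op_scale[OF sm] by (simp add: fun_scale_def algebra_simps)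
  then show ?thesis
    unfolding raise_eigenspace_def using raise_op_section[OF f] by auto
qed

text \<open>Converse to \<open>raise_op_eigen\<close>. The first conclusion later shows that
  \<open>lower_op b\<close> is injective on the shifted eigenspace when \<nu> \<noteq> 0.\<close>

lemma lower_op_eigen:
  assumes u: "u \<in> raise_eigenspace (b + 2) (\<nu> - of_nat (b + 2))"
  shows "raise_op (lower_op b u) = fun_scale \<nu> u" "lower_op b u \<in> raise_eigenspace b \<nu>"
proof -
  have f: "u \<in> forms (b + 2) 0" and e: "lower_op (b + 2) (raise_op u) = fun_scale (\<nu> - of_nat (b + 2)) u"
    using u by (auto simp: raise_eigenspace_def)
  note sm = forms_0_smooth[OF f]
  show 1: "raise_op (lower_op b u) = fun_scale \<nu> u"
    using raise_lower_commute[OF sm, of b] unfolding e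
    by (simp add: fun_eq_iff fun_scale_def algebra_simps)
  show "lower_op b u \<in> raise_eigenspace b \<nu>"
    unfolding raise_eigenspace_def using lower_op_section[OF f]
    by (simp add: 1 lower_op_scale[OF sm])
qed

lemma lower_op_image:
  assumes "\<nu> \<noteq> 0"
  shows "lower_op b ` raise_eigenspace (b + 2) (\<nu> - of_nat (b + 2)) = raise_eigenspace b \<nu>"
proof (intro equalityI subsetI)
  fix u assume u: "u \<in> raise_eigenspace b \<nu>"
  \<comment> \<open>\<open>lower_op b\<close> after \<open>raise_op\<close> multiplies u by \<nu>,
    so dividing by \<nu> gives a preimage.\<close>
  let ?v = "fun_scale (1 / \<nu>) (raise_op u)"
  have f: "u \<in> forms b 0" and e: "lower_op b (raise_op u) = fun_scale \<nu> u"
    using u by (auto simp: raise_eigenspace_def)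
  note r = raise_op_eigen[OF u]
  have sm: "smooth (raise_op u)" by (rule raise_op_smooth[OF forms_0_smooth[OF f]])
  have "?v \<in> raise_eigenspace (b + 2) (\<nu> - of_nat (b + 2))"
    using r cfun.subspace_scale[OF forms_0_subspace] raise_op_scale[OF sm] lower_op_scale[OF raise_op_smooth[OF sm]]
    by (auto simp: raise_eigenspace_def cfun.scale_scale mult.commute)
  moreover have "lower_op b ?v = u"
    using assms unfolding lower_op_scale[OF sm] e by (simp add: fun_scale_def)
  ultimately show "u \<in> lower_op b ` raise_eigenspace (b + 2) (\<nu> - of_nat (b + 2))" by force
qed (use lower_op_eigen(2) in auto)

text \<open>(n+1)(n+b+2) - (b+2) = n(n+b+3), so one raising passes from (n + 1, b) to (n, b + 2),
  and the dimension formula takes the same value at both pairs. This is why b is arbitrary in the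
  induction.\<close>

lemma raise_eigenspace_dim:
  "has_dim (raise_eigenspace b (of_nat (n * (n + b + 1)))) (2 * n + b + 1)"
proof (induction n arbitrary: b)
  case 0
  show ?case using has_dim_polynomials[of b] by (simp add: raise_eigenspace_0)
next
  case (Suc n)
  let ?\<nu> = "of_nat (Suc n * (Suc n + b + 1)) :: complex"
  let ?V = "raise_eigenspace (b + 2) (?\<nu> - of_nat (b + 2))"
  have nz: "?\<nu> \<noteq> 0" by (simp only: of_nat_eq_0_iff) simp
  have "?\<nu> - of_nat (b + 2) = of_nat (n * (n + (b + 2) + 1))"
    by (simp add: algebra_simps)
  then have V: "has_dim ?V (2 * n + (b + 2) + 1)"
    using Suc[of "b + 2"] by simp
  have sm: "smooth u" if "u \<in> ?V" for u
    using that unfolding raise_eigenspace_def by (blast intro: forms_0_smooth)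
  have "has_dim (lower_op b ` ?V) (2 * n + (b + 2) + 1)"
  proof (rule has_dim_image[OF V])
    show "lower_op b (u + v) = lower_op b u + lower_op b v" if "u \<in> ?V" "v \<in> ?V" for u v
      using that by (intro lower_op_add sm)
    show "lower_op b (fun_scale c u) = fun_scale c (lower_op b u)" if "u \<in> ?V" for c u
      using that by (intro lower_op_scale sm)
    show "u = 0" if u: "u \<in> ?V" and l: "lower_op b u = 0" for u
    proof -
      have "raise_op 0 = 0"
        using raise_op_scale[OF smooth_const[of 0], of 0] by (simp add: fun_scale_def zero_fun_def)
      then have "fun_scale ?\<nu> u = 0" using lower_op_eigen(1)[OF u] l by simp
      then show "u = 0" using nz cfun.scale_eq_0_iff by blast
    qed
  qed
  then show ?case unfolding lower_op_image[OF nz] by simp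
qed

text \<open>Each application of \<open>raise_op\<close> lowers the real part by at least 2, so k
  bounds the number of steps; at k = 0 the real part would be negative, against
  \<open>raise_eigenvalue_nonneg\<close>.\<close>

lemma raise_eigenvalue_cases:
  assumes "u \<in> raise_eigenspace b \<nu>" "u \<noteq> 0"
  shows "\<exists>n. \<nu> = of_nat (n * (n + b + 1))"
proof -
  have "Re \<nu> < real k \<Longrightarrow> u \<in> raise_eigenspace b \<nu> \<Longrightarrow> u \<noteq> 0 \<Longrightarrow> \<exists>n. \<nu> = of_nat (n * (n + b + 1))" for k
  proof (induction k arbitrary: b \<nu> u)
    case 0
    obtain r where "r \<ge> 0" "\<nu> = of_real r"
      using raise_eigenvalue_nonneg[OF 0(2,3)] by blast
    with 0(1) show ?case by simp
  next
    case (Suc k)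
    show ?case
    proof (cases "\<nu> = 0")
      case True
      then show ?thesis by (intro exI[of _ 0]) simp
    next
      case False
      have "raise_op u \<noteq> 0"
      proof
        assume "raise_op u = 0"
        then have "u \<in> raise_eigenspace b 0"
          using Suc.prems(2) by (simp add: raise_eigenspace_0_iff) (simp add: raise_eigenspace_def)
        then have "fun_scale \<nu> u = fun_scale 0 u"
          using Suc.prems(2) by (simp add: raise_eigenspace_def)
        then show False using False Suc.prems(3) by (simp add: fun_eq_iff fun_scale_def)
      qed
      moreover have "Re (\<nu> - of_nat (b + 2)) < real k"
        using Suc.prems(1) by simp
      ultimately obtain n where n: "\<nu> - of_nat (b + 2) = of_nat (n * (n + (b + 2) + 1))"
        using Suc.IH[OF _ raise_op_eigen[OF Suc.prems(2)]] by blast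
      have "\<nu> = of_nat (Suc n * (Suc n + b + 1))"
        using n by (simp add: algebra_simps)
      then show ?thesis by blast
    qed
  qed
  moreover obtain k where "Re \<nu> < real k" using reals_Archimedean2 by blast
  ultimately show ?thesis using assms by blast
qed

section \<open>Transfer of the spectrum to (0,1)-forms\<close>

lemma eigenspace_1_iff:
  "f \<in> eigenspace a 1 \<mu> \<longleftrightarrow>
     (\<lambda>z. rho z ^ 2 * f z) \<in> raise_eigenspace (a + 2) (\<mu> - of_nat (a + 2))"
proof (cases "f \<in> forms a 1")
  case False
  then show ?thesis
    unfolding eigenspace_def raise_eigenspace_def form_1_section_iff by simp
next
  case True
  let ?u = "\<lambda>z. rho z ^ 2 * f z"
  have u: "?u \<in> forms (a + 2) 0" using True by (simp only: form_1_section_iff)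
  have "laplacian a 1 f = fun_scale \<mu> f \<longleftrightarrow> raise_op (lower_op a ?u) = fun_scale \<mu> ?u"
    unfolding laplacian_1[OF True] raise_op_def by (auto simp: fun_eq_iff fun_scale_def)
  also have "\<dots> \<longleftrightarrow> lower_op (a + 2) (raise_op ?u) = fun_scale (\<mu> - of_nat (a + 2)) ?u"
    using raise_lower_commute[OF forms_0_smooth[OF u], of a]
    by (auto simp: fun_eq_iff fun_scale_def algebra_simps)
  finally show ?thesis
    using True u by (simp add: eigenspace_def raise_eigenspace_def)
qed

lemma eigenspace_1_eq:
  "eigenspace a 1 \<mu> = (\<lambda>u z. u z / rho z ^ 2) ` raise_eigenspace (a + 2) (\<mu> - of_nat (a + 2))"
proof (intro equalityI subsetI)
  fix f assume f: "f \<in> eigenspace a 1 \<mu>"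
  then show "f \<in> (\<lambda>u z. u z / rho z ^ 2) ` raise_eigenspace (a + 2) (\<mu> - of_nat (a + 2))"
    unfolding eigenspace_1_iff by (intro image_eqI[of _ _ "\<lambda>z. rho z ^ 2 * f z"]) auto
next
  fix f assume "f \<in> (\<lambda>u z. u z / rho z ^ 2) ` raise_eigenspace (a + 2) (\<mu> - of_nat (a + 2))"
  then show "f \<in> eigenspace a 1 \<mu>"
    unfolding eigenspace_1_iff by auto
qed

text \<open>With n = k + 1 the shift by a + 2 turns n(n+a+1) into k(k+a+3), an eigenvalue on O(a+2).
  The kernel there, k = 0, corresponds to the eigenvalue a + 2 on forms, which is why n starts at
  1.\<close>

lemma eigenspace_1_dim:
  assumes "n \<ge> 1"
  shows "cfun.dim (eigenspace a 1 (of_nat (n * (n + a + 1)))) = 2 * n + a + 1"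
proof -
  obtain k where n: "n = Suc k" using assms by (cases n) auto
  have "of_nat (n * (n + a + 1)) - of_nat (a + 2) = (of_nat (k * (k + (a + 2) + 1)) :: complex)"
    by (simp add: n algebra_simps)
  then have "has_dim (raise_eigenspace (a + 2) (of_nat (n * (n + a + 1)) - of_nat (a + 2))) (2 * n + a + 1)"
    using raise_eigenspace_dim[of "a + 2" k] by (simp add: n)
  then have "has_dim (eigenspace a 1 (of_nat (n * (n + a + 1)))) (2 * n + a + 1)"
    unfolding eigenspace_1_eq
    by (rule has_dim_image) (auto simp: fun_eq_iff fun_scale_def add_divide_distrib)
  then show ?thesis by (rule has_dim_dim)
qed

lemma nonzero_eigenvalues_1:
  "nonzero_eigenvalues a 1 = (\<lambda>n. of_nat (n * (n + a + 1))) ` {n. 1 \<le> n}"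
proof (intro equalityI subsetI)
  fix \<mu> assume "\<mu> \<in> nonzero_eigenvalues a 1"
  then obtain f where "f \<in> eigenspace a 1 \<mu>" "f \<noteq> 0" by (auto simp: nonzero_eigenvalues_def)
  then have "(\<lambda>z. rho z ^ 2 * f z) \<in> raise_eigenspace (a + 2) (\<mu> - of_nat (a + 2))"
    "(\<lambda>z. rho z ^ 2 * f z) \<noteq> 0"
    unfolding eigenspace_1_iff by (auto simp: fun_eq_iff)
  from raise_eigenvalue_cases[OF this]
  obtain n where "\<mu> - of_nat (a + 2) = of_nat (n * (n + (a + 2) + 1))" by blast
  then have "\<mu> = of_nat (Suc n * (Suc n + a + 1))" by (simp add: algebra_simps)
  then show "\<mu> \<in> (\<lambda>n. of_nat (n * (n + a + 1))) ` {n. 1 \<le> n}" by (intro image_eqI[of _ _ "Suc n"]) auto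
next
  fix \<mu> :: complex assume "\<mu> \<in> (\<lambda>n. of_nat (n * (n + a + 1))) ` {n. 1 \<le> n}"
  then obtain n where n: "1 \<le> n" "\<mu> = of_nat (n * (n + a + 1))" by auto
  have "\<mu> \<noteq> 0" unfolding n(2) of_nat_eq_0_iff using n(1) by simp
  moreover have "\<exists>f\<in>eigenspace a 1 \<mu>. f \<noteq> 0"
  proof (rule ccontr)
    \<comment> \<open>An eigenspace without nonzero elements would have dimension 0, against 2n + a
      + 1 > 0.\<close>
    assume "\<not> ?thesis"
    then have "eigenspace a 1 \<mu> \<subseteq> cfun.span {}" by auto
    then have "cfun.dim (eigenspace a 1 \<mu>) \<le> card ({} :: (complex \<Rightarrow> complex) set)"
      by (rule cfun.dim_le_card) simp
    then show False using eigenspace_1_dim[OF n(1), of a] n(2) by simp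
  qed
  ultimately show "\<mu> \<in> nonzero_eigenvalues a 1" by (simp add: nonzero_eigenvalues_def)
qed

section \<open>Analytic continuation and the Riemann zeta function\<close>

text \<open>Two continuations live on half-planes whose intersection is again a half-plane, hence
  connected. Far to the right both equal the sum, so the identity theorem makes their difference
  vanish at s.\<close>

lemma continuation_eqI:
  assumes "b < Re s" and Z: "Z meromorphic_on {t. b < Re t}"
    and sum: "\<And>t. c < Re t \<Longrightarrow> ((\<lambda>i. F i t) has_sum Z t) I"
    and an: "Z analytic_on {s}"
  shows "continuation F I s = Z s"
  unfolding continuation_def
proof (rule the_equality)
  show "\<exists>Z' b c. b < Re s \<and> Z' meromorphic_on {t. b < Re t} \<and>
     (\<forall>t. c < Re t \<longrightarrow> ((\<lambda>i. F i t) has_sum Z' t) I) \<and> Z' analytic_on {s} \<and> Z s = Z' s"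
    using assms by blast
  fix w
  assume "\<exists>Z' b c. b < Re s \<and> Z' meromorphic_on {t. b < Re t} \<and>
     (\<forall>t. c < Re t \<longrightarrow> ((\<lambda>i. F i t) has_sum Z' t) I) \<and> Z' analytic_on {s} \<and> w = Z' s"
  then obtain Z' b' c' where b': "b' < Re s" and Z': "Z' meromorphic_on {t. b' < Re t}"
    and sum': "\<And>t. c' < Re t \<Longrightarrow> ((\<lambda>i. F i t) has_sum Z' t) I"
    and an': "Z' analytic_on {s}" and w: "w = Z' s" by blast
  define S where "S = {t. max b b' < Re t}"
  \<comment> \<open>This normalises the stray values a meromorphic function may take at isolated
    points, and changes nothing at s, where both continuations are analytic.\<close>
  define h where "h = remove_sings (\<lambda>t. Z t - Z' t)"
  define t0 where "t0 = complex_of_real (max (max b b') (max c c') + 1)"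
  have "open S" "connected S"
    unfolding S_def by (rule open_halfspace_Re_gt, intro convex_connected convex_halfspace_Re_gt)
  moreover have "s \<in> S" "t0 \<in> S"
    using b' assms(1) by (auto simp: S_def t0_def)
  ultimately have S: "open S" "connected S" "s \<in> S" "t0 \<in> S" .
  have "(\<lambda>t. Z t - Z' t) meromorphic_on S"
    by (intro meromorphic_on_diff meromorphic_on_subset[OF Z] meromorphic_on_subset[OF Z']) (auto simp: S_def)
  then have h: "h nicely_meromorphic_on S"
    unfolding h_def by (rule remove_sings_nicely_meromorphic)
  let ?U = "{t. max c c' < Re t}"
  have ev: "eventually (\<lambda>t. t \<in> ?U) (nhds t)" if "t \<in> ?U" for t
    by (intro eventually_nhds_in_open open_halfspace_Re_gt that)
  have eq: "Z t - Z' t = 0" if "t \<in> ?U" for t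
    using that sum[of t] sum'[of t] has_sum_unique by force
  have "h t = 0" if t: "t \<in> ?U" for t
  proof -
    have "eventually (\<lambda>t. Z t - Z' t = 0) (at t)"
      using ev[OF t] eq unfolding eventually_at_filter by (auto elim: eventually_mono)
    then have "((\<lambda>t. Z t - Z' t) \<longlongrightarrow> 0) (at t)"
      by (rule tendsto_eventually)
    then show ?thesis unfolding h_def by (rule remove_sings_eqI)
  qed
  moreover have t0: "t0 \<in> ?U" by (auto simp: t0_def)
  ultimately have "eventually (\<lambda>t. h t = 0) (at t0)"
    using ev[OF t0] unfolding eventually_at_filter by (auto elim: eventually_mono)
  then have "frequently (\<lambda>t. h t = 0) (at t0)"
    by (intro eventually_frequently) auto
  from frequently_eq_meromorphic_imp_constant[OF this h S(1,2,4,3)]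
  have "h s = 0" .
  moreover have "(\<lambda>t. Z t - Z' t) analytic_on {s}"
    by (intro analytic_on_diff an an')
  ultimately show "w = Z s" unfolding h_def w by simp
qed

text \<open>\<open>p * (Re s - \<sigma>) + 1\<close> exceeds 1 exactly when Re s > \<sigma>, which
  gives a convergent majorant. As |s| enters only through a monotone C, the majorant is uniform on
  discs, as the Weierstrass test requires.\<close>

lemma halfplane_series:
  fixes f :: "nat \<Rightarrow> complex \<Rightarrow> complex" and p \<sigma> :: real
  assumes p: "p > 0" and hol: "\<And>n. f n holomorphic_on {s. \<sigma> < Re s}"
    and C: "mono C" "\<And>r. 0 \<le> C r"
    and bound: "\<And>n s. \<sigma> < Re s \<Longrightarrow>
      cmod (f n s) \<le> C (cmod s) * real (Suc n) powr (- (p * (Re s - \<sigma>) + 1))"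
  shows "(\<lambda>s. \<Sum>n. f n s) holomorphic_on {s. \<sigma> < Re s}"
    and "\<And>s. \<sigma> < Re s \<Longrightarrow> summable (\<lambda>n. cmod (f n s))"
proof -
  have summ: "summable (\<lambda>n. K * real (Suc n) powr (- (p * e + 1)))" if "e > 0" for e K
  proof -
    have "summable (\<lambda>n. real n powr (- (p * e + 1)))"
      using that p by (subst summable_real_powr_iff) (simp add: mult_pos_pos)
    then have "summable (\<lambda>n. real (Suc n) powr (- (p * e + 1)))"
      by (subst summable_Suc_iff)
    then show ?thesis by (rule summable_mult)
  qed
  show "summable (\<lambda>n. cmod (f n s))" if s: "\<sigma> < Re s" for s
    by (rule summable_comparison_test'[OF summ[of "Re s - \<sigma>" "C (cmod s)"]])
       (use s bound[OF s] in auto)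
  show "(\<lambda>s. \<Sum>n. f n s) holomorphic_on {s. \<sigma> < Re s}"
  proof (rule holomorphic_uniform_sequence)
    show "open {s. \<sigma> < Re s}" by (rule open_halfspace_Re_gt)
    show "(\<lambda>s. \<Sum>k<n. f k s) holomorphic_on {s. \<sigma> < Re s}" for n
      by (intro holomorphic_intros hol)
    fix x assume "x \<in> {s. \<sigma> < Re s}"
    then have x: "\<sigma> < Re x" by simp
    define d where "d = (Re x - \<sigma>) / 2"
    have d: "d > 0" using x by (simp add: d_def)
    have ball: "d \<le> Re s - \<sigma>" "cmod s \<le> cmod x + d" if "s \<in> cball x d" for s
    proof -
      have n: "cmod (s - x) \<le> d" using that by (simp add: dist_norm norm_minus_commute)
      have "\<bar>Re (s - x)\<bar> \<le> d" using n abs_Re_le_cmod[of "s - x"] by simp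
      moreover have "2 * d = Re x - \<sigma>" by (simp add: d_def)
      ultimately show "d \<le> Re s - \<sigma>" by simp
      show "cmod s \<le> cmod x + d" using n norm_triangle_ineq[of x "s - x"] by simp
    qed
    have "uniform_limit (cball x d) (\<lambda>n s. \<Sum>k<n. f k s) (\<lambda>s. \<Sum>n. f n s) sequentially"
    proof (rule Weierstrass_m_test[OF _ summ[OF d, of "C (cmod x + d)"]])
      fix n s assume s: "s \<in> cball x d"
      have "cmod (f n s) \<le> C (cmod s) * real (Suc n) powr (- (p * (Re s - \<sigma>) + 1))"
        using ball(1)[OF s] d by (intro bound) auto
      also have "\<dots> \<le> C (cmod x + d) * real (Suc n) powr (- (p * d + 1))"
        using ball[OF s] p C by (intro mult_mono powr_mono monoD[OF C(1)]) auto
      finally show "cmod (f n s) \<le> C (cmod x + d) * real (Suc n) powr (- (p * d + 1))" .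
    qed
    moreover have "cball x d \<subseteq> {s. \<sigma> < Re s}" using ball(1) d by fastforce
    ultimately show "\<exists>d>0. cball x d \<subseteq> {s. \<sigma> < Re s} \<and>
        uniform_limit (cball x d) (\<lambda>n s. \<Sum>k<n. f k s) (\<lambda>s. \<Sum>n. f n s) sequentially"
      using d by blast
  qed
qed

section \<open>Euler-Maclaurin summation and the continuation of zeta\<close>

lemma vanishing_bound:
  fixes g :: "real \<Rightarrow> complex"
  assumes "g a = 0" and "\<And>y. a \<le> y \<Longrightarrow> y \<le> x \<Longrightarrow> (g has_vector_derivative g' y) (at y)"
    and "\<And>y. a \<le> y \<Longrightarrow> y \<le> x \<Longrightarrow> cmod (g' y) \<le> B" and "a \<le> x"
  shows "cmod (g x) \<le> B * (x - a)"
proof -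
  have "cmod (g x - g a) \<le> B * norm (x - a)"
  proof (rule differentiable_bound[OF convex_real_interval(5)[of a x]])
    fix y assume y: "y \<in> {a..x}"
    show "(g has_derivative (\<lambda>h. h *\<^sub>R g' y)) (at y within {a..x})"
      using assms(2)[of y] y unfolding has_vector_derivative_def by (auto intro: has_derivative_at_withinI)
    show "onorm (\<lambda>h. h *\<^sub>R g' y) \<le> B"
      by (rule onorm_le) (use assms(3)[of y] y in \<open>auto simp: mult.commute[of B] intro: mult_left_mono\<close>)
  qed (use assms(4) in auto)
  then show ?thesis using assms(1,4) by simp
qed

text \<open>Let the right endpoint vary: E is the corrected error on [a, x]. E and its first two
  derivatives vanish at a, and the coefficient 1/12 makes the third collapse to -(x-a)^2 f4(x) / 12.
  Three integrations over length at most 1 keep the bound M / 12.\<close>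

lemma trapezoid_bound:
  fixes f f1 f2 f3 f4 F :: "real \<Rightarrow> complex"
  assumes d: "\<And>x. a \<le> x \<Longrightarrow> x \<le> a + 1 \<Longrightarrow> (F has_vector_derivative f x) (at x)"
    "\<And>x. a \<le> x \<Longrightarrow> x \<le> a + 1 \<Longrightarrow> (f has_vector_derivative f1 x) (at x)"
    "\<And>x. a \<le> x \<Longrightarrow> x \<le> a + 1 \<Longrightarrow> (f1 has_vector_derivative f2 x) (at x)"
    "\<And>x. a \<le> x \<Longrightarrow> x \<le> a + 1 \<Longrightarrow> (f2 has_vector_derivative f3 x) (at x)"
    "\<And>x. a \<le> x \<Longrightarrow> x \<le> a + 1 \<Longrightarrow> (f3 has_vector_derivative f4 x) (at x)"
    and M: "\<And>x. a \<le> x \<Longrightarrow> x \<le> a + 1 \<Longrightarrow> cmod (f4 x) \<le> M"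
  shows "cmod ((f a + f (a + 1)) / 2 - (F (a + 1) - F a) + (f1 a - f1 (a + 1)) / 12) \<le> M / 12"
proof -
  define E where "E x = of_real (x - a) * (f a + f x) / 2 - (F x - F a) + of_real ((x - a)\<^sup>2) * (f1 a - f1 x) / 12" for x
  define E1 where "E1 x = (f a - f x) / 2 + of_real (x - a) * f1 x / 2 + of_real (x - a) * (f1 a - f1 x) / 6
     - of_real ((x - a)\<^sup>2) * f2 x / 12" for x
  define E2 where "E2 x = of_real (x - a) * f2 x / 6 + (f1 a - f1 x) / 6 - of_real ((x - a)\<^sup>2) * f3 x / 12" for x
  have M0: "0 \<le> M" using order_trans[OF norm_ge_zero M[of a]] by simp
  have E: "(E has_vector_derivative E1 x) (at x)" if "a \<le> x" "x \<le> a + 1" for x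
    unfolding E_def E1_def using that
    by (auto intro!: derivative_eq_intros d simp: field_simps power2_eq_square scaleR_conv_of_real)
  have E1: "(E1 has_vector_derivative E2 x) (at x)" if "a \<le> x" "x \<le> a + 1" for x
    unfolding E1_def E2_def using that
    by (auto intro!: derivative_eq_intros d simp: field_simps power2_eq_square scaleR_conv_of_real)
  have E2: "(E2 has_vector_derivative - of_real ((x - a)\<^sup>2) * f4 x / 12) (at x)" if "a \<le> x" "x \<le> a + 1" for x
    unfolding E2_def using that
    by (auto intro!: derivative_eq_intros d simp: field_simps power2_eq_square scaleR_conv_of_real)
  have b3: "cmod (- of_real ((x - a)\<^sup>2) * f4 x / 12) \<le> M / 12" if x: "a \<le> x" "x \<le> a + 1" for x
  proof -
    have "cmod (- of_real ((x - a)\<^sup>2) * f4 x / 12) = (x - a)\<^sup>2 * cmod (f4 x) / 12"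
      by (simp only: norm_mult norm_divide norm_minus_cancel norm_of_real) simp
    also have "(x - a)\<^sup>2 * cmod (f4 x) \<le> 1 * M"
      using x M by (intro mult_mono power_le_one) auto
    finally show ?thesis by simp
  qed
  have step: "cmod (g x) \<le> M / 12"
    if "g a = 0" "\<And>y. a \<le> y \<Longrightarrow> y \<le> a + 1 \<Longrightarrow> (g has_vector_derivative g' y) (at y)"
      "\<And>y. a \<le> y \<Longrightarrow> y \<le> a + 1 \<Longrightarrow> cmod (g' y) \<le> M / 12" "a \<le> x" "x \<le> a + 1" for g g' x
  proof -
    have "cmod (g x) \<le> M / 12 * (x - a)"
      by (rule vanishing_bound[of g a x g']) (use that in auto)
    also have "\<dots> \<le> M / 12 * 1"
      using M0 that by (intro mult_left_mono) auto
    finally show ?thesis by simp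
  qed
  have b2: "cmod (E2 x) \<le> M / 12" if x: "a \<le> x" "x \<le> a + 1" for x
    by (rule step[OF _ E2 b3 x]) (simp add: E2_def)
  have b1: "cmod (E1 x) \<le> M / 12" if x: "a \<le> x" "x \<le> a + 1" for x
    by (rule step[OF _ E1 b2 x]) (simp add: E1_def)
  have "cmod (E (a + 1)) \<le> M / 12"
    by (rule step[OF _ E b1]) (simp_all add: E_def)
  then show ?thesis by (simp add: E_def)
qed

lemma has_vector_derivative_powr_complex:
  fixes w :: complex
  assumes "x > 0"
  shows "((\<lambda>x. of_real x powr w) has_vector_derivative w * of_real x powr (w - 1)) (at x)"
proof -
  have "((\<lambda>z. z powr w) has_field_derivative w * of_real x powr (w - 1)) (at (of_real x))"
    using assms by (intro has_field_derivative_powr) (auto simp: complex_nonpos_Reals_iff)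
  then show ?thesis by (rule has_vector_derivative_real_field)
qed

lemma norm_powr_pos: "x > 0 \<Longrightarrow> cmod (of_real x powr w) = x powr Re w"
  by (simp add: norm_powr_real_powr)

text \<open>
  \<open>s - 1\<close> times the error of the trapezoidal rule with the first Euler-Maclaurin correction, for
  \<open>x\<^sup>-\<^sup>s\<close> on \<open>[n, n + 1]\<close>.
\<close>

definition zeta_term :: "nat \<Rightarrow> complex \<Rightarrow> complex" where
  "zeta_term n s = (s - 1) * (of_nat n powr (- s) + of_nat (n + 1) powr (- s)) / 2
     - (of_nat n powr (1 - s) - of_nat (n + 1) powr (1 - s))
     - s * (s - 1) * (of_nat n powr (- s - 1) - of_nat (n + 1) powr (- s - 1)) / 12"

text \<open>The trapezoidal estimate is applied to (s-1) x^(-s) with antiderivative -x^(1-s); the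
  factor s - 1 keeps this regular at the pole s = 1. The other four linear factors come from four
  differentiations.\<close>

lemma zeta_term_bound:
  assumes n: "n \<ge> 1" and s: "Re s > - 4"
  shows "cmod (zeta_term n s) \<le>
     cmod ((s - 1) * (- s) * (- s - 1) * (- s - 2) * (- s - 3)) * real n powr (- Re s - 4) / 12"
proof -
  define a where "a = real n"
  have a: "a > 0" using n by (simp add: a_def)
  note der = has_vector_derivative_mult_right[OF has_vector_derivative_powr_complex]
  have e: "- s - 1 - 1 = - s - 2" "- s - 2 - 1 = - s - 3" "- s - 3 - 1 = - s - 4" "1 - s - 1 = - s" by simp_all
  have "cmod (((s - 1) * of_real a powr (- s) + (s - 1) * of_real (a + 1) powr (- s)) / 2
     - (- 1 * of_real (a + 1) powr (1 - s) - - 1 * of_real a powr (1 - s))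
     + ((s - 1) * (- s) * of_real a powr (- s - 1) - (s - 1) * (- s) * of_real (a + 1) powr (- s - 1)) / 12)
     \<le> (cmod ((s - 1) * (- s) * (- s - 1) * (- s - 2) * (- s - 3)) * a powr (- Re s - 4)) / 12"
  proof (rule trapezoid_bound)
    fix x assume x: "a \<le> x" "x \<le> a + 1"
    then have x0: "x > 0" using a by simp
    show "((\<lambda>x. - 1 * of_real x powr (1 - s)) has_vector_derivative (s - 1) * of_real x powr (- s)) (at x)"
      using der[OF x0, of "- 1" "1 - s"] by (simp add: e algebra_simps)
    show "((\<lambda>x. (s - 1) * of_real x powr (- s)) has_vector_derivative
        (s - 1) * (- s) * of_real x powr (- s - 1)) (at x)"
      using der[OF x0, of "s - 1" "- s"] by (simp only: mult.assoc)
    show "((\<lambda>x. (s - 1) * (- s) * of_real x powr (- s - 1)) has_vector_derivative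
        (s - 1) * (- s) * (- s - 1) * of_real x powr (- s - 2)) (at x)"
      using der[OF x0, of "(s - 1) * (- s)" "- s - 1"] by (simp only: mult.assoc e)
    show "((\<lambda>x. (s - 1) * (- s) * (- s - 1) * of_real x powr (- s - 2)) has_vector_derivative
        (s - 1) * (- s) * (- s - 1) * (- s - 2) * of_real x powr (- s - 3)) (at x)"
      using der[OF x0, of "(s - 1) * (- s) * (- s - 1)" "- s - 2"] by (simp only: mult.assoc e)
    show "((\<lambda>x. (s - 1) * (- s) * (- s - 1) * (- s - 2) * of_real x powr (- s - 3)) has_vector_derivative
        (s - 1) * (- s) * (- s - 1) * (- s - 2) * (- s - 3) * of_real x powr (- s - 4)) (at x)"
      using der[OF x0, of "(s - 1) * (- s) * (- s - 1) * (- s - 2)" "- s - 3"] by (simp only: mult.assoc e)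
    have "x powr (- Re s - 4) \<le> a powr (- Re s - 4)"
      using x a s by (intro powr_mono2') auto
    then show "cmod ((s - 1) * (- s) * (- s - 1) * (- s - 2) * (- s - 3) * of_real x powr (- s - 4)) \<le>
        cmod ((s - 1) * (- s) * (- s - 1) * (- s - 2) * (- s - 3)) * a powr (- Re s - 4)"
      using norm_powr_pos[OF x0, of "- s - 4"]
      by (simp only: norm_mult[of _ "of_real x powr (- s - 4)"]) (auto intro: mult_left_mono)
  qed
  also have "((s - 1) * of_real a powr (- s) + (s - 1) * of_real (a + 1) powr (- s)) / 2
     - (- 1 * of_real (a + 1) powr (1 - s) - - 1 * of_real a powr (1 - s))
     + ((s - 1) * (- s) * of_real a powr (- s - 1) - (s - 1) * (- s) * of_real (a + 1) powr (- s - 1)) / 12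
     = zeta_term n s"
    by (simp add: zeta_term_def a_def algebra_simps add_divide_distrib diff_divide_distrib)
  finally show ?thesis unfolding a_def .
qed

text \<open>This is (s-1) zeta(s). The explicit summands compensate the boundary terms at n = 1 in
  the sum of \<open>zeta_term\<close>.\<close>

definition zeta_num :: "complex \<Rightarrow> complex" where
  "zeta_num s = 1 + (s - 1) / 2 + s * (s - 1) / 12 + (\<Sum>n. zeta_term (Suc n) s)"

lemma zeta_term_series:
  shows "(\<lambda>s. \<Sum>n. zeta_term (Suc n) s) holomorphic_on {s. - 3 < Re s}"
    and "\<And>s. - 3 < Re s \<Longrightarrow> summable (\<lambda>n. cmod (zeta_term (Suc n) s))"
proof -
  \<comment> \<open>Each of the five linear factors in s is at most |s| + 3; \<open>max 0 r\<close>
    makes C monotone and nonnegative on all reals.\<close>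
  define C :: "real \<Rightarrow> real" where "C r = (max 0 r + 3) ^ 5" for r
  have C: "mono C" "\<And>r. 0 \<le> C r"
    by (auto simp: C_def intro!: monoI power_mono)
  have hol: "zeta_term (Suc n) holomorphic_on {s. - 3 < Re s}" for n
    unfolding zeta_term_def by (intro holomorphic_intros) (auto simp del: of_nat_Suc simp: of_nat_eq_0_iff)
  have bound: "cmod (zeta_term (Suc n) s) \<le> C (cmod s) * real (Suc n) powr (- (1 * (Re s - (- 3)) + 1))"
    if s: "- 3 < Re s" for n s
  proof -
    have 1: "cmod (s - 1) \<le> cmod s + 3" "cmod (- s) \<le> cmod s + 3" "cmod (- s - 1) \<le> cmod s + 3"
      "cmod (- s - 2) \<le> cmod s + 3" "cmod (- s - 3) \<le> cmod s + 3"
      using norm_triangle_ineq4[of s 1] norm_triangle_ineq4[of "- s" 1] norm_triangle_ineq4[of "- s" 2]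
        norm_triangle_ineq4[of "- s" 3] by auto
    have "cmod ((s - 1) * (- s) * (- s - 1) * (- s - 2) * (- s - 3)) \<le>
        (cmod s + 3) * (cmod s + 3) * (cmod s + 3) * (cmod s + 3) * (cmod s + 3)"
      unfolding norm_mult by (intro mult_mono 1 mult_nonneg_nonneg) auto
    also have "\<dots> = C (cmod s)" by (simp add: C_def eval_nat_numeral)
    finally have "cmod ((s - 1) * (- s) * (- s - 1) * (- s - 2) * (- s - 3)) * real (Suc n) powr (- Re s - 4)
        \<le> C (cmod s) * real (Suc n) powr (- Re s - 4)"
      by (rule mult_right_mono) simp
    moreover have "cmod (zeta_term (Suc n) s) \<le>
        cmod ((s - 1) * (- s) * (- s - 1) * (- s - 2) * (- s - 3)) * real (Suc n) powr (- Re s - 4) / 12"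
      using s by (intro zeta_term_bound) auto
    moreover have "0 \<le> C (cmod s) * real (Suc n) powr (- Re s - 4)"
      by (intro mult_nonneg_nonneg C) auto
    ultimately have "cmod (zeta_term (Suc n) s) \<le> C (cmod s) * real (Suc n) powr (- Re s - 4)"
      by linarith
    moreover have "- (1 * (Re s - (- 3)) + 1) = - Re s - 4" by simp
    ultimately show ?thesis by (simp only:)
  qed
  note ser = halfplane_series[OF zero_less_one hol C bound]
  show "(\<lambda>s. \<Sum>n. zeta_term (Suc n) s) holomorphic_on {s. - 3 < Re s}" by (rule ser)
  show "summable (\<lambda>n. cmod (zeta_term (Suc n) s))" if "- 3 < Re s" for s by (rule ser(2)[OF _ that]) auto
qed

lemma has_sum_atLeast_1_iff: "(f has_sum S) {n::nat. 1 \<le> n} \<longleftrightarrow> ((\<lambda>n. f (Suc n)) has_sum S) UNIV"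
proof -
  have "{n::nat. 1 \<le> n} = range Suc"
    by (auto simp: image_iff Suc_le_eq gr0_conv_Suc)
  then show ?thesis by (simp add: has_sum_reindex o_def)
qed

lemma has_sum_diff:
  fixes f g :: "'i \<Rightarrow> complex"
  assumes "(f has_sum a) A" "(g has_sum b) A"
  shows "((\<lambda>x. f x - g x) has_sum (a - b)) A"
  using has_sum_add[OF assms(1), of "\<lambda>x. - g x" "- b"] assms(2) by (simp add: has_sum_uminus)

lemma has_sum_shift:
  fixes f :: "nat \<Rightarrow> complex"
  assumes "(f has_sum S) {n. 1 \<le> n}"
  shows "((\<lambda>n. f (n + m)) has_sum (S - (\<Sum>k=1..m. f k))) {n. 1 \<le> n}"
proof -
  have "(f has_sum (S - sum f {1..m})) ({n. 1 \<le> n} - {1..m})"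
    by (rule has_sum_Diff[OF assms]) auto
  moreover have "{n. 1 \<le> n} - {1..m} = (\<lambda>n. n + m) ` {n. 1 \<le> n}"
  proof (intro equalityI subsetI)
    fix k assume "k \<in> {n. 1 \<le> n} - {1..m}"
    then show "k \<in> (\<lambda>n. n + m) ` {n. 1 \<le> n}" by (intro image_eqI[of _ _ "k - m"]) auto
  qed auto
  ultimately show ?thesis by (simp add: has_sum_reindex o_def)
qed

lemma powr_nat_tendsto_0:
  assumes "Re w < 0"
  shows "(\<lambda>n. of_nat (Suc n) powr w) \<longlonglongrightarrow> (0 :: complex)"
proof (rule tendsto_norm_zero_cancel)
  have "(\<lambda>n. real (Suc n) powr Re w) \<longlonglongrightarrow> 0"
    using tendsto_neg_powr[OF assms filterlim_real_sequentially] by (rule LIMSEQ_Suc)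
  moreover have "cmod (of_nat (Suc n) powr w) = real (Suc n) powr Re w" for n
    using norm_powr_pos[of "real (Suc n)" w] by simp
  ultimately show "(\<lambda>n. cmod (of_nat (Suc n) powr w)) \<longlonglongrightarrow> 0" by simp
qed

lemma telescope_powr_sums:
  assumes "Re w < 0"
  shows "(\<lambda>n. of_nat (Suc n) powr w - of_nat (Suc n + 1) powr w) sums (1 :: complex)"
  using telescope_sums'[OF powr_nat_tendsto_0[OF assms]] by simp

definition zeta_ext :: "complex \<Rightarrow> complex" where
  "zeta_ext s = zeta_num s / (s - 1)"

text \<open>The trapezoid samples sum to the Dirichlet series T and to T - 1, the series without its
  first term; the two other differences telescope to 1. Solving for T gives the claim.\<close>

lemma zeta_ext_has_sum:
  assumes s: "1 < Re s"
  shows "((\<lambda>n. of_nat n powr (- s)) has_sum zeta_ext s) {n::nat. 1 \<le> n}"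
proof -
  have nrm: "cmod (of_nat (Suc n) powr (- s)) = real (Suc n) powr (- Re s)" for n
    using norm_powr_pos[of "real (Suc n)" "- s"] by simp
  have "summable (\<lambda>n. real n powr (- Re s))"
    using s by (subst summable_real_powr_iff) simp
  then have summ: "summable (\<lambda>n. cmod (of_nat (Suc n) powr (- s)))"
    unfolding nrm by (subst summable_Suc_iff)
  define T where "T = (\<Sum>n. (of_nat (Suc n) powr (- s) :: complex))"
  have T: "(\<lambda>n. of_nat (Suc n) powr (- s)) sums T"
    unfolding T_def using summable_norm_cancel[OF summ] by (rule summable_sums)
  then have T': "(\<lambda>n. of_nat (Suc n + 1) powr (- s)) sums (T - 1)"
    using sums_split_initial_segment[OF T, of 1] by simp
  have "(\<lambda>n. zeta_term (Suc n) s) sums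
      ((s - 1) * (T + (T - 1)) / 2 - 1 - s * (s - 1) * 1 / 12)"
    unfolding zeta_term_def
    by (intro sums_diff sums_divide sums_mult sums_add T T' telescope_powr_sums) (use s in auto)
  then have "(\<Sum>n. zeta_term (Suc n) s) = (s - 1) * (T + (T - 1)) / 2 - 1 - s * (s - 1) * 1 / 12"
    by (rule sums_unique[symmetric])
  then have "zeta_num s = (s - 1) * T"
    by (simp add: zeta_num_def field_simps)
  then have "zeta_ext s = T"
    using s by (auto simp: zeta_ext_def)
  then show ?thesis
    unfolding has_sum_atLeast_1_iff using norm_summable_imp_has_sum[OF summ T] by simp
qed

lemma zeta_num_analytic: "zeta_num analytic_on {s. - 3 < Re s}"
  unfolding zeta_num_def
  by (intro analytic_intros) (use zeta_term_series(1) in \<open>auto simp: analytic_on_open open_halfspace_Re_gt\<close>)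

lemma riemann_zeta_eq:
  assumes "- 3 < Re s" "s \<noteq> 1"
  shows "riemann_zeta s = zeta_ext s"
  unfolding riemann_zeta_def
proof (rule continuation_eqI[where b = "- 3" and c = 1])
  show "zeta_ext meromorphic_on {t. - 3 < Re t}"
    unfolding zeta_ext_def
    by (intro meromorphic_intros analytic_on_imp_meromorphic_on zeta_num_analytic analytic_intros)
  show "zeta_ext analytic_on {s}"
    unfolding zeta_ext_def
    by (intro analytic_intros analytic_on_subset[OF zeta_num_analytic]) (use assms in auto)
qed (use assms zeta_ext_has_sum in auto)

text \<open>
  This equals \<open>(2n + m) u v - n u\<^sup>2 - (n + m) v\<^sup>2 - (m/2) (1 - s) (u\<^sup>2 - v\<^sup>2)\<close>.  In the factored form
  both factors vanish at \<open>s = 0\<close> and are small for large \<open>n\<close>.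
\<close>

definition pair_term :: "nat \<Rightarrow> nat \<Rightarrow> complex \<Rightarrow> complex" where
  "pair_term m n s =
     (let u = of_nat n powr (- s); v = of_nat (n + m) powr (- s)
      in (u - v) / 2 * (s * of_nat m * (u + v) - of_nat (n + (n + m)) * (u - v)))"

text \<open>Both factors are studied as functions of the right endpoint x, with f x = x^(-s) in
  place of v. They vanish at x = n, and their derivatives carry |s| and have order 1/n relative to
  f; for the second factor B this is the cancellation that the coefficient s provides.\<close>

lemma pair_term_bound:
  assumes n: "n \<ge> 1" and s: "Re s > - 1 / 2"
  shows "cmod (pair_term m n s) \<le>
    (cmod s)\<^sup>2 * (1 + cmod s) * (real m ^ 3 * (1 + real m)\<^sup>2) * real n powr (- 2 - 2 * Re s)"
proof -
  define a where "a = real n"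
  \<comment> \<open>Q bounds |f| on [n, n + m]: x/n lies between 1 and 1 + m, and -Re s \<le> 1
    gives (x/n)^(-Re s) \<le> 1 + m.\<close>
  define Q where "Q = (1 + real m) * a powr (- Re s)"
  define f where "f x = complex_of_real x powr (- s)" for x :: real
  define f' where "f' x = - s * f x / of_real x" for x
  have a: "a \<ge> 1" using n by (simp add: a_def)
  have Q: "0 \<le> Q" by (simp add: Q_def)
  have fQ: "cmod (f x) \<le> Q" if x: "a \<le> x" "x \<le> a + real m" for x
  proof -
    have x0: "x > 0" using x a by simp
    have "1 \<le> x / a" using x a by simp
    have "x / a \<le> 1 + real m / a" using x a by (simp add: field_simps)
    also have "\<dots> \<le> 1 + real m" using a mult_left_mono[OF a, of "real m"] by (simp add: divide_le_eq)
    finally have xa: "x / a \<le> 1 + real m" .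
    have "(x / a) powr (- Re s) \<le> (x / a) powr 1"
      using \<open>1 \<le> x / a\<close> s by (intro powr_mono) auto
    also have "\<dots> \<le> 1 + real m" using xa \<open>1 \<le> x / a\<close> by simp
    finally have p: "(x / a) powr (- Re s) \<le> 1 + real m" .
    have "cmod (f x) = (a * (x / a)) powr (- Re s)"
      using norm_powr_pos[OF x0, of "- s"] a by (simp add: f_def)
    also have "\<dots> = (x / a) powr (- Re s) * a powr (- Re s)"
      using a x0 by (subst powr_mult) auto
    also have "\<dots> \<le> Q"
      unfolding Q_def by (intro mult_right_mono p) auto
    finally show ?thesis .
  qed
  have df: "(f has_vector_derivative f' x) (at x)" if "a \<le> x" for x
  proof -
    have x0: "x > 0" using that a by simp
    have "of_real x powr (- s - 1) = of_real x powr (- s) / complex_of_real x"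
      using x0 by (subst powr_diff) auto
    then show ?thesis
      using has_vector_derivative_powr_complex[OF x0, of "- s"] by (simp add: f_def[abs_def] f'_def)
  qed
  have f'Q: "cmod (f' x) \<le> cmod s * Q / a" if x: "a \<le> x" "x \<le> a + real m" for x
  proof -
    have "cmod (f' x) = cmod s * cmod (f x) / x"
      using x a by (simp add: f'_def norm_mult norm_divide)
    also have "\<dots> \<le> cmod s * Q / a"
      using x a fQ[OF x] Q by (intro frac_le mult_left_mono) auto
    finally show ?thesis .
  qed
  have uf: "cmod (f a - f x) \<le> cmod s * Q / a * real m" if x: "a \<le> x" "x \<le> a + real m" for x
  proof -
    have "cmod (f a - f x) \<le> cmod s * Q / a * (x - a)"
    proof (rule vanishing_bound[where g = "\<lambda>x. f a - f x" and g' = "\<lambda>x. 0 - f' x"])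
      show "((\<lambda>x. f a - f x) has_vector_derivative 0 - f' y) (at y)" if "a \<le> y" for y
        by (intro has_vector_derivative_diff has_vector_derivative_const df that)
      show "cmod (0 - f' y) \<le> cmod s * Q / a" if "a \<le> y" "y \<le> x" for y
        using f'Q[of y] that x by simp
    qed (use x in auto)
    also have "\<dots> \<le> cmod s * Q / a * real m"
      using x a Q by (intro mult_left_mono) auto
    finally show ?thesis .
  qed
  define B where "B x = s * of_real (x - a) * (f a + f x) - of_real (a + x) * (f a - f x)" for x
  \<comment> \<open>Substituting f' x = -s f(x)/x cancels the main terms; what remains carries f a -
    f x, 1 - a/x or f', all small for large n.\<close>
  define B' where "B' x = s * (f a - f x) + s * f x * of_real (1 - a / x) - (f a - f x) + s * of_real (x - a) * f' x" for x
  have dB: "(B has_vector_derivative B' x) (at x)" if x: "a \<le> x" for x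
  proof -
    have x0: "x \<noteq> 0" using x a by simp
    have "(B has_vector_derivative s * (f a + f x) + s * of_real (x - a) * f' x
        - ((f a - f x) + of_real (a + x) * (- f' x))) (at x)"
      unfolding B_def
      by (auto intro!: derivative_eq_intros df x simp: scaleR_conv_of_real algebra_simps)
    also have "s * (f a + f x) + s * of_real (x - a) * f' x - ((f a - f x) + of_real (a + x) * (- f' x)) = B' x"
      using x0 by (simp add: B'_def f'_def field_simps)
    finally show ?thesis .
  qed
  have B'b: "cmod (B' x) \<le> cmod s * (2 + 2 * cmod s) * real m * Q / a" if x: "a \<le> x" "x \<le> a + real m" for x
  proof -
    have x0: "x > 0" using x a by simp
    have "1 - a / x = (x - a) / x" using x0 by (simp add: field_simps)
    then have "\<bar>1 - a / x\<bar> = (x - a) / x" using x x0 by simp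
    also have "\<dots> \<le> real m / a" using x a by (intro frac_le) auto
    finally have ax: "\<bar>1 - a / x\<bar> \<le> real m / a" .
    have 1: "cmod (s * (f a - f x)) \<le> cmod s * (cmod s * Q / a * real m)"
      unfolding norm_mult by (intro mult_left_mono uf x) auto
    have 2: "cmod (s * f x * of_real (1 - a / x)) \<le> cmod s * Q * (real m / a)"
      unfolding norm_mult norm_of_real by (intro mult_mono ax fQ x mult_nonneg_nonneg Q) auto
    have 3: "cmod (s * of_real (x - a) * f' x) \<le> cmod s * real m * (cmod s * Q / a)"
      unfolding norm_mult norm_of_real by (intro mult_mono f'Q x mult_nonneg_nonneg) (use x in auto)
    have "cmod (B' x) \<le> cmod (s * (f a - f x)) + cmod (s * f x * of_real (1 - a / x)) + cmod (f a - f x)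
        + cmod (s * of_real (x - a) * f' x)"
      unfolding B'_def
      by (intro order_trans[OF norm_triangle_ineq] add_mono order_trans[OF norm_triangle_ineq4] order_refl)
    also have "\<dots> \<le> cmod s * (cmod s * Q / a * real m) + cmod s * Q * (real m / a) + cmod s * Q / a * real m
        + cmod s * real m * (cmod s * Q / a)"
      by (intro add_mono 1 2 3 uf x)
    also have "\<dots> = cmod s * (2 + 2 * cmod s) * real m * Q / a"
      by (simp add: field_simps add_divide_distrib)
    finally show ?thesis .
  qed
  have "cmod (B (a + real m)) \<le> cmod s * (2 + 2 * cmod s) * real m * Q / a * (a + real m - a)"
    by (rule vanishing_bound[OF _ dB B'b]) (simp_all add: B_def)
  then have Bb: "cmod (B (a + real m)) \<le> cmod s * (2 + 2 * cmod s) * real m * Q / a * real m" by simp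
  have eq: "pair_term m n s = (f a - f (a + real m)) / 2 * B (a + real m)"
    by (simp add: pair_term_def Let_def B_def f_def a_def algebra_simps)
  have "cmod (pair_term m n s) = cmod (f a - f (a + real m)) / 2 * cmod (B (a + real m))"
    unfolding eq by (simp add: norm_mult norm_divide)
  also have "\<dots> \<le> (cmod s * Q / a * real m) / 2 * (cmod s * (2 + 2 * cmod s) * real m * Q / a * real m)"
    by (intro mult_mono Bb divide_right_mono uf) (use a Q in auto)
  also have "\<dots> = (cmod s)\<^sup>2 * (1 + cmod s) * real m ^ 3 * (Q\<^sup>2 / a\<^sup>2)"
    using a by (simp add: field_simps power2_eq_square eval_nat_numeral)
  also have "Q\<^sup>2 / a\<^sup>2 = (1 + real m)\<^sup>2 * a powr (- 2 - 2 * Re s)"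
  proof -
    have "(a powr (- Re s))\<^sup>2 / a\<^sup>2 = a powr (- Re s + - Re s) / a powr 2"
      using a by (simp only: power2_eq_square powr_add) (simp add: powr_numeral power2_eq_square)
    also have "\<dots> = a powr (- 2 - 2 * Re s)"
      unfolding powr_diff[symmetric] by (rule arg_cong[of _ _ "\<lambda>e. a powr e"]) simp
    finally have "(a powr (- Re s))\<^sup>2 / a\<^sup>2 = a powr (- 2 - 2 * Re s)" .
    then show ?thesis
      unfolding Q_def power_mult_distrib times_divide_eq_right[symmetric] by (simp only:)
  qed
  finally show ?thesis by (simp add: a_def mult_ac)
qed

section \<open>The spectral zeta function\<close>

lemma pair_term_holomorphic: "n \<ge> 1 \<Longrightarrow> pair_term m n holomorphic_on A"
  unfolding pair_term_def Let_def by (intro holomorphic_intros) auto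

text \<open>The exponent -2 - 2 Re s equals -(2 (Re s + 1/2) + 1), which fixes p = 2 and the
  abscissa -1/2.\<close>

lemma pair_term_series:
  shows "(\<lambda>s. \<Sum>n. pair_term m (Suc n) s) holomorphic_on {s. - 1 / 2 < Re s}"
    and "\<And>s. - 1 / 2 < Re s \<Longrightarrow> summable (\<lambda>n. cmod (pair_term m (Suc n) s))"
proof -
  define C :: "real \<Rightarrow> real" where
    "C r = (max 0 r)\<^sup>2 * (1 + max 0 r) * (real m ^ 3 * (1 + real m)\<^sup>2)" for r
  have C: "mono C" "\<And>r. 0 \<le> C r"
    by (auto simp: C_def intro!: monoI mult_mono power_mono)
  have hol: "pair_term m (Suc n) holomorphic_on {s. - 1 / 2 < Re s}" for n
    by (rule pair_term_holomorphic) simp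
  have bound: "cmod (pair_term m (Suc n) s) \<le> C (cmod s) * real (Suc n) powr (- (2 * (Re s - (- 1 / 2)) + 1))"
    if s: "- 1 / 2 < Re s" for n s
  proof -
    have "- (2 * (Re s - (- 1 / 2)) + 1) = - 2 - 2 * Re s" by simp
    then show ?thesis
      using pair_term_bound[of "Suc n" s m] s by (simp only: C_def) simp
  qed
  note ser = halfplane_series[OF _ hol C bound]
  show "(\<lambda>s. \<Sum>n. pair_term m (Suc n) s) holomorphic_on {s. - 1 / 2 < Re s}" by (rule ser) auto
  show "summable (\<lambda>n. cmod (pair_term m (Suc n) s))" if "- 1 / 2 < Re s" for s by (rule ser(2)[OF _ _ that]) auto
qed

text \<open>\<open>pair_term_bound\<close> carries the square of |s|. For |s| \<le> 1/4 the exponent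
  of n is at most -3/2, so one convergent series serves the whole disc.\<close>

lemma pair_series_deriv_0:
  "((\<lambda>s. \<Sum>n. pair_term m (Suc n) s) has_field_derivative 0) (at 0)"
proof -
  define R where "R s = (\<Sum>n. pair_term m (Suc n) s)" for s
  define K where "K = 2 * (real m ^ 3 * (1 + real m)\<^sup>2) * (\<Sum>n. real (Suc n) powr (- 3 / 2))"
  have "summable (\<lambda>n. real n powr (- 3 / 2))"
    by (subst summable_real_powr_iff) simp
  then have summ: "summable (\<lambda>n. real (Suc n) powr (- 3 / 2))"
    by (subst summable_Suc_iff)
  have bound: "cmod (R s) \<le> (cmod s)\<^sup>2 * K" if s: "cmod s \<le> 1 / 4" for s
  proof -
    have re: "- 1 / 4 \<le> Re s" using abs_Re_le_cmod[of s] s by linarith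
    have "- 2 - 2 * Re s \<le> - 2 - 2 * (- 1 / 4)" by (intro diff_left_mono mult_left_mono re) auto
    then have "- 2 - 2 * Re s \<le> - 3 / 2" by simp
    have le: "cmod (pair_term m (Suc n) s) \<le> (cmod s)\<^sup>2 * 2 * (real m ^ 3 * (1 + real m)\<^sup>2) * real (Suc n) powr (- 3 / 2)" for n
    proof -
      have "cmod (pair_term m (Suc n) s) \<le>
          (cmod s)\<^sup>2 * (1 + cmod s) * (real m ^ 3 * (1 + real m)\<^sup>2) * real (Suc n) powr (- 2 - 2 * Re s)"
        by (rule pair_term_bound) (use re in auto)
      also have "\<dots> \<le> (cmod s)\<^sup>2 * 2 * (real m ^ 3 * (1 + real m)\<^sup>2) * real (Suc n) powr (- 3 / 2)"
        using s \<open>- 2 - 2 * Re s \<le> - 3 / 2\<close> by (intro mult_mono powr_mono mult_nonneg_nonneg) auto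
      finally show ?thesis .
    qed
    have summ': "summable (\<lambda>n. cmod (pair_term m (Suc n) s))"
      using re by (intro pair_term_series) auto
    have "cmod (R s) \<le> (\<Sum>n. cmod (pair_term m (Suc n) s))"
      unfolding R_def by (rule summable_norm[OF summ'])
    also have "\<dots> \<le> (\<Sum>n. (cmod s)\<^sup>2 * 2 * (real m ^ 3 * (1 + real m)\<^sup>2) * real (Suc n) powr (- 3 / 2))"
      by (intro suminf_le le summ' summable_mult summ)
    also have "\<dots> = (cmod s)\<^sup>2 * K"
      using suminf_mult[OF summ, of "(cmod s)\<^sup>2 * 2 * (real m ^ 3 * (1 + real m)\<^sup>2)"]
      by (simp add: K_def mult_ac)
    finally show ?thesis .
  qed
  have R0: "R 0 = 0" using bound[of 0] by simp
  have "eventually (\<lambda>s. s \<in> ball 0 (1 / 4) - {0}) (at (0::complex))"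
    by (intro eventually_at_in_open) auto
  then have "eventually (\<lambda>s. cmod ((R s - R 0) / (s - 0)) \<le> cmod s * K) (at 0)"
  proof eventually_elim
    case (elim s)
    then have "cmod (R s) / cmod s \<le> (cmod s)\<^sup>2 * K / cmod s"
      using bound[of s] by (intro divide_right_mono) auto
    then show ?case using elim by (simp add: R0 norm_divide power2_eq_square)
  qed
  moreover have "((\<lambda>s. cmod s * K) \<longlongrightarrow> 0) (at 0)"
    by (auto intro!: tendsto_eq_intros)
  ultimately have "((\<lambda>s. (R s - R 0) / (s - 0)) \<longlongrightarrow> 0) (at 0)"
    by (rule Lim_null_comparison)
  then show ?thesis
    unfolding R_def[abs_def] by (simp add: has_field_derivative_iff)
qed

text \<open>The sum over n + m lacks the terms k = 1, ..., m of the full series, and the sum of u^2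
  - v^2 telescopes to such terms; hence the two finite sums.\<close>

definition pair_zeta :: "nat \<Rightarrow> complex \<Rightarrow> complex" where
  "pair_zeta m t = 2 * zeta_ext (2 * t - 1) - (\<Sum>k=1..m. of_nat k powr (1 - 2 * t))
     + of_nat m / 2 * (1 - t) * (\<Sum>k=1..m. of_nat k powr (- 2 * t)) + (\<Sum>n. pair_term m (Suc n) t)"

lemma pair_term_eq:
  assumes n: "n \<ge> 1"
  shows "of_nat (n + (n + m)) * of_nat (n * (n + m)) powr (- t) =
    pair_term m n t + (of_nat n powr (- (2 * t - 1)) + of_nat (n + m) powr (- (2 * t - 1)))
     + of_nat m / 2 * (1 - t) * (of_nat n powr (- (2 * t)) - of_nat (n + m) powr (- (2 * t)))"
proof -
  define u v where "u = (of_nat n :: complex) powr (- t)" and "v = (of_nat (n + m) :: complex) powr (- t)"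
  have pw: "of_nat k powr (- (2 * t)) = (of_nat k powr (- t))\<^sup>2"
    "of_nat k powr (- (2 * t - 1)) = of_nat k * (of_nat k powr (- t))\<^sup>2" if "k \<ge> 1" for k :: nat
  proof -
    show 1: "of_nat k powr (- (2 * t)) = ((of_nat k :: complex) powr (- t))\<^sup>2"
      by (simp add: power2_eq_square flip: powr_add)
    have "- (2 * t - 1) = - (2 * t) + 1" by simp
    then show "of_nat k powr (- (2 * t - 1)) = of_nat k * ((of_nat k :: complex) powr (- t))\<^sup>2"
      using that by (simp only: powr_add 1) simp
  qed
  \<comment> \<open>Complex powers are not multiplicative in general; nonnegative real bases make
    them so.\<close>
  have "of_nat (n * (n + m)) powr (- t) = u * v"
  proof -
    have "of_nat (n * (n + m)) = complex_of_real (real n) * complex_of_real (real (n + m))" by simp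
    then show ?thesis
      using powr_times_real[of "complex_of_real (real n)" "complex_of_real (real (n + m))" "- t"]
      by (simp add: u_def v_def)
  qed
  moreover have "of_nat n powr (- (2 * t - 1)) = of_nat n * u\<^sup>2" "of_nat n powr (- (2 * t)) = u\<^sup>2"
    "of_nat (n + m) powr (- (2 * t - 1)) = of_nat (n + m) * v\<^sup>2" "of_nat (n + m) powr (- (2 * t)) = v\<^sup>2"
    using n by (simp_all only: u_def v_def pw trans_le_add1)
  moreover have "pair_term m n t = (u - v) / 2 * (t * of_nat m * (u + v) - of_nat (n + (n + m)) * (u - v))"
    by (simp only: pair_term_def Let_def u_def v_def)
  ultimately show ?thesis
    by (simp only:) (simp add: field_simps power2_eq_square)
qed

text \<open>The two values \<open>zeta_ext (2 * t)\<close> cancel, so the pole of zeta(2t) at t =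
  1/2 leaves no trace in \<open>pair_zeta\<close>.\<close>

lemma pair_zeta_has_sum:
  assumes t: "1 < Re t"
  shows "((\<lambda>n. of_nat (n + (n + m)) * of_nat (n * (n + m)) powr (- t)) has_sum pair_zeta m t) {n::nat. 1 \<le> n}"
proof -
  have z1: "((\<lambda>n. of_nat n powr (- (2 * t - 1))) has_sum zeta_ext (2 * t - 1)) {n::nat. 1 \<le> n}"
    by (rule zeta_ext_has_sum) (use t in simp)
  have z2: "((\<lambda>n. of_nat n powr (- (2 * t))) has_sum zeta_ext (2 * t)) {n::nat. 1 \<le> n}"
    by (rule zeta_ext_has_sum) (use t in simp)
  have summ: "summable (\<lambda>n. cmod (pair_term m (Suc n) t))"
    by (rule pair_term_series) (use t in simp)
  have R: "((\<lambda>n. pair_term m n t) has_sum (\<Sum>n. pair_term m (Suc n) t)) {n. 1 \<le> n}"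
    unfolding has_sum_atLeast_1_iff
    by (rule norm_summable_imp_has_sum[OF summ summable_sums[OF summable_norm_cancel[OF summ]]])
  have "((\<lambda>n. pair_term m n t + (of_nat n powr (- (2 * t - 1)) + of_nat (n + m) powr (- (2 * t - 1)))
     + of_nat m / 2 * (1 - t) * (of_nat n powr (- (2 * t)) - of_nat (n + m) powr (- (2 * t)))) has_sum
     ((\<Sum>n. pair_term m (Suc n) t) + (zeta_ext (2 * t - 1) + (zeta_ext (2 * t - 1) - (\<Sum>k=1..m. of_nat k powr (- (2 * t - 1)))))
     + of_nat m / 2 * (1 - t) * (zeta_ext (2 * t) - (zeta_ext (2 * t) - (\<Sum>k=1..m. of_nat k powr (- (2 * t))))))) {n. 1 \<le> n}"
    by (intro has_sum_add has_sum_diff has_sum_cmult_right R z1 z2 has_sum_shift[OF z1] has_sum_shift[OF z2])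
  also have "(\<Sum>n. pair_term m (Suc n) t) + (zeta_ext (2 * t - 1) + (zeta_ext (2 * t - 1) - (\<Sum>k=1..m. of_nat k powr (- (2 * t - 1)))))
     + of_nat m / 2 * (1 - t) * (zeta_ext (2 * t) - (zeta_ext (2 * t) - (\<Sum>k=1..m. of_nat k powr (- (2 * t))))) = pair_zeta m t"
    by (simp add: pair_zeta_def)
  finally show ?thesis
    by (subst has_sum_cong[OF pair_term_eq]) auto
qed

lemma pair_zeta_meromorphic: "pair_zeta m meromorphic_on {t. - 1 / 2 < Re t}"
  and pair_zeta_analytic: "- 1 / 2 < Re s \<Longrightarrow> s \<noteq> 1 \<Longrightarrow> pair_zeta m analytic_on {s}"
proof -
  have num: "(\<lambda>t. zeta_num (2 * t - 1)) analytic_on {t. - 1 / 2 < Re t}"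
    by (rule analytic_on_compose_gen[OF _ zeta_num_analytic, of "\<lambda>t. 2 * t - 1", unfolded o_def])
       (auto intro!: analytic_intros)
  have ser: "(\<lambda>s. \<Sum>n. pair_term m (Suc n) s) analytic_on {s. - 1 / 2 < Re s}"
    using pair_term_series(1)[of m] open_halfspace_Re_gt[of "- 1 / 2"] by (simp add: analytic_on_open)
  have pow: "(\<lambda>t. of_nat k powr (1 - 2 * t)) analytic_on A" "(\<lambda>t. of_nat k powr (- 2 * t)) analytic_on A"
    if "k \<in> {1..m}" for k and A :: "complex set"
    by (rule analytic_on_subset[OF _ subset_UNIV], subst analytic_on_open[OF open_UNIV],
        intro holomorphic_intros; use that in auto)+
  show "pair_zeta m meromorphic_on {t. - 1 / 2 < Re t}"
    unfolding pair_zeta_def zeta_ext_def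
    by (intro meromorphic_intros analytic_on_imp_meromorphic_on[OF num] analytic_on_imp_meromorphic_on[OF ser]
        analytic_on_imp_meromorphic_on[OF pow(1)] analytic_on_imp_meromorphic_on[OF pow(2)])
       (auto intro!: analytic_intros)
  show "pair_zeta m analytic_on {s}" if s: "- 1 / 2 < Re s" "s \<noteq> 1"
    unfolding pair_zeta_def zeta_ext_def
    by (intro analytic_intros analytic_on_subset[OF num] analytic_on_subset[OF ser] pow) (use s in auto)
qed

lemma pair_zeta_deriv_0:
  "deriv (pair_zeta m) 0 = 4 * deriv riemann_zeta (- 1)
     + of_real (2 * (\<Sum>k=1..m. real k * ln (real k)) - real m * (\<Sum>k=1..m. ln (real k)) - (real m)\<^sup>2 / 2)"
proof -
  \<comment> \<open>A derivative needs agreement on a neighbourhood of -1; this strip stays left of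
    the pole at 1.\<close>
  have ev: "eventually (\<lambda>s. s \<in> {s. - 3 < Re s} \<inter> {s. Re s < 1}) (nhds (- 1))"
    by (intro eventually_nhds_in_open open_Int open_halfspace_Re_gt open_halfspace_Re_lt) auto
  then have "eventually (\<lambda>s. riemann_zeta s = zeta_ext s) (nhds (- 1))"
    by eventually_elim (auto intro!: riemann_zeta_eq)
  then have dz: "deriv riemann_zeta (- 1) = deriv zeta_ext (- 1)"
    by (rule deriv_cong_ev) simp
  have "zeta_ext analytic_on {- 1}"
    unfolding zeta_ext_def by (intro analytic_intros analytic_on_subset[OF zeta_num_analytic]) auto
  then have "(zeta_ext has_field_derivative deriv zeta_ext (- 1)) (at (2 * 0 - 1))"
    using analytic_on_imp_differentiable_at[of zeta_ext "{- 1}" "- 1"] DERIV_deriv_iff_field_differentiable by auto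
  then have d1: "((\<lambda>t. zeta_ext (2 * t - 1)) has_field_derivative deriv zeta_ext (- 1) * 2) (at 0)"
    by (rule DERIV_chain2) (auto intro!: derivative_eq_intros)
  have pw: "((\<lambda>t. of_nat k powr (c - 2 * t)) has_field_derivative of_real (ln (real k)) * of_nat k powr (c - 2 * 0) * (- 2)) (at (0::complex))"
    if "k \<in> {1..m}" for k c
  proof -
    have k: "complex_of_real (ln (real k)) = Ln (of_nat k)" "(of_nat k :: complex) \<noteq> 0"
      using that by (auto simp: Ln_of_nat)
    show ?thesis unfolding k(1)
      by (rule DERIV_chain2[OF has_field_derivative_powr_right[OF k(2)]]) (auto intro!: derivative_eq_intros)
  qed
  have d2: "((\<lambda>t. of_nat k powr (1 - 2 * t)) has_field_derivative of_real (- 2 * (real k * ln (real k)))) (at (0::complex))"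
    if "k \<in> {1..m}" for k
    using pw[OF that, of 1] that by (simp add: mult_ac)
  have d3: "((\<lambda>t. of_nat k powr (- 2 * t)) has_field_derivative of_real (- 2 * ln (real k))) (at (0::complex))"
    if "k \<in> {1..m}" for k
    using pw[OF that, of 0] that by (simp add: mult_ac)
  have "(pair_zeta m has_field_derivative
      (2 * (deriv zeta_ext (- 1) * 2) - (\<Sum>k=1..m. of_real (- 2 * (real k * ln (real k))))
      + (of_nat m / 2 * (0 - 1) * (\<Sum>k=1..m. of_nat k powr (- 2 * 0)) +
         (\<Sum>k=1..m. of_real (- 2 * ln (real k))) * (of_nat m / 2 * (1 - 0))) + 0)) (at 0)"
    unfolding pair_zeta_def
    by (intro DERIV_add DERIV_diff DERIV_mult DERIV_cmult DERIV_sum DERIV_const DERIV_ident d1 d2 d3 pair_series_deriv_0)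
  also have "(2 * (deriv zeta_ext (- 1) * 2) - (\<Sum>k=1..m. of_real (- 2 * (real k * ln (real k))))
      + (of_nat m / 2 * (0 - 1) * (\<Sum>k=1..m. of_nat k powr (- 2 * 0)) +
         (\<Sum>k=1..m. of_real (- 2 * ln (real k))) * (of_nat m / 2 * (1 - 0))) + 0)
     = 4 * deriv riemann_zeta (- 1)
     + of_real (2 * (\<Sum>k=1..m. real k * ln (real k)) - real m * (\<Sum>k=1..m. ln (real k)) - (real m)\<^sup>2 / 2)"
  proof -
    have "(\<Sum>k=1..m. (of_nat k powr (- 2 * 0) :: complex)) = of_nat m" by simp
    moreover have "(\<Sum>k=1..m. complex_of_real (- 2 * (real k * ln (real k)))) = of_real (- 2 * (\<Sum>k=1..m. real k * ln (real k)))"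
      by (simp add: sum_distrib_left sum_negf)
    moreover have "(\<Sum>k=1..m. complex_of_real (- 2 * ln (real k))) = of_real (- 2 * (\<Sum>k=1..m. ln (real k)))"
      by (simp add: sum_distrib_left sum_negf)
    ultimately show ?thesis unfolding dz by (simp only:) (simp add: field_simps power2_eq_square)
  qed
  finally show ?thesis by (rule DERIV_imp_deriv)
qed

section \<open>The product of factorials and the final identification\<close>

lemma ln_fact_sum: "ln (fact n :: real) = (\<Sum>k=1..n. ln (real k))"
  by (induction n) (simp_all add: ln_mult_pos)

text \<open>In the sum of ln(i!) over i \<le> a the term ln k occurs for i = k, ..., a, that is a +
  1 - k times.\<close>

lemma sum_ln_fact:
  "(\<Sum>i=0..a. ln (fact i :: real)) + (\<Sum>k=1..a+1. real k * ln (real k)) = real (a + 1) * (\<Sum>k=1..a+1. ln (real k))"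
  by (induction a) (simp_all add: ln_fact_sum algebra_simps)

text \<open>The reflection of i to a - i makes both numerator factors contribute equally, so
  \<open>sum_ln_fact\<close> is used twice. The result is the negative of the logarithmic part of
  \<open>pair_zeta_deriv_0\<close> at m = a + 1.\<close>

lemma ln_prod_fact:
  "ln (\<Prod>i=0..a. fact i * fact (a - i) / fact (a + 1)) =
     real (a + 1) * (\<Sum>k=1..a+1. ln (real k)) - 2 * (\<Sum>k=1..a+1. real k * ln (real k))"
proof -
  have "ln (\<Prod>i=0..a. fact i * fact (a - i) / fact (a + 1)) =
      (\<Sum>i=0..a. ln (fact i * fact (a - i) / fact (a + 1) :: real))"
    by (intro ln_prod) auto
  also have "\<dots> = (\<Sum>i=0..a. ln (fact i :: real) + ln (fact (a - i)) - ln (fact (a + 1)))"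
    by (intro sum.cong) (simp_all add: ln_div ln_mult_pos del: fact_Suc)
  also have "\<dots> = (\<Sum>i=0..a. ln (fact i)) + (\<Sum>i=0..a. ln (fact (a - i))) - real (a + 1) * ln (fact (a + 1))"
    by (simp add: sum.distrib sum_subtractf del: fact_Suc)
  also have "(\<Sum>i=0..a. ln (fact (a - i) :: real)) = (\<Sum>i=0..a. ln (fact i))"
    using sum.atLeastAtMost_rev[of "\<lambda>i. ln (fact i :: real)" 0 a] by simp
  finally show ?thesis
    using sum_ln_fact[of a] ln_fact_sum[of "a + 1"] by (simp del: fact_Suc)
qed

lemma spectral_zeta_1_eq:
  assumes s: "- 1 / 2 < Re s" "s \<noteq> 1"
  shows "spectral_zeta a 1 s = pair_zeta (a + 1) s"
  unfolding spectral_zeta_def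
proof (rule continuation_eqI[where b = "- 1 / 2" and c = 1])
  fix t assume t: "1 < Re t"
  let ?h = "\<lambda>n. of_nat (n * (n + a + 1)) :: complex"
  \<comment> \<open>The series runs over the set of eigenvalues, so different n must give different
    eigenvalues for the multiplicities to be right.\<close>
  have inj: "inj_on ?h {n. 1 \<le> n}"
  proof (rule inj_onI)
    fix i j assume "?h i = ?h j"
    then have eq: "i * (i + a + 1) = j * (j + a + 1)" by (simp only: of_nat_eq_iff)
    have "i * (i + a + 1) < j * (j + a + 1)" if "i < j" for i j :: nat
      using that by (intro mult_strict_mono) auto
    then show "i = j" using eq by (metis less_irrefl linorder_neqE_nat)
  qed
  have "((\<lambda>n. of_nat (n + (n + (a + 1))) * of_nat (n * (n + (a + 1))) powr (- t)) has_sum pair_zeta (a + 1) t)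
      {n::nat. 1 \<le> n}"
    by (rule pair_zeta_has_sum[OF t])
  moreover have "of_nat (n + (n + (a + 1))) * of_nat (n * (n + (a + 1))) powr (- t) =
      ((\<lambda>\<mu>. of_nat (cfun.dim (eigenspace a 1 \<mu>)) * \<mu> powr (- t)) \<circ> ?h) n" if "n \<in> {n. 1 \<le> n}" for n
  proof -
    have "n + (n + (a + 1)) = 2 * n + a + 1" "n + (a + 1) = n + a + 1" by simp_all
    moreover have "cfun.dim (eigenspace a 1 (?h n)) = 2 * n + a + 1"
      using that by (intro eigenspace_1_dim) simp
    ultimately show ?thesis by (simp only: o_apply)
  qed
  ultimately have "(((\<lambda>\<mu>. of_nat (cfun.dim (eigenspace a 1 \<mu>)) * \<mu> powr (- t)) \<circ> ?h) has_sum pair_zeta (a + 1) t) {n. 1 \<le> n}"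
    by (rule has_sum_cong[THEN iffD1, rotated])
  then show "((\<lambda>\<mu>. of_nat (cfun.dim (eigenspace a 1 \<mu>)) * \<mu> powr (- t)) has_sum pair_zeta (a + 1) t)
      (nonzero_eigenvalues a 1)"
    unfolding nonzero_eigenvalues_1 has_sum_reindex[OF inj] .
qed (use s pair_zeta_meromorphic pair_zeta_analytic in auto)

theorem theorem2p14:
  fixes a :: nat
  shows "analytic_torsion a =
    1 / 2 * (of_nat a + 1)\<^sup>2
    + of_real (ln (\<Prod>i=0..a. fact i * fact (a - i) / fact (a + 1)))
    - 4 * deriv riemann_zeta (- 1)"
proof -
  have "eventually (\<lambda>s. s \<in> {s. - 1 / 2 < Re s} \<inter> {s. Re s < 1}) (nhds 0)"
    by (intro eventually_nhds_in_open open_Int open_halfspace_Re_gt open_halfspace_Re_lt) auto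
  then have "eventually (\<lambda>s. spectral_zeta a 1 s = pair_zeta (a + 1) s) (nhds 0)"
    by eventually_elim (rule spectral_zeta_1_eq, auto)
  then have "deriv (spectral_zeta a 1) 0 = deriv (pair_zeta (a + 1)) 0"
    by (rule deriv_cong_ev) simp
  \<comment> \<open>The weight q removes the functions, q = 0, and the sign is that of q =
    1.\<close>
  moreover have "analytic_torsion a = - deriv (spectral_zeta a 1) 0"
    by (simp add: analytic_torsion_def)
  ultimately show ?thesis
    unfolding ln_prod_fact pair_zeta_deriv_0 by (simp add: field_simps power2_eq_square)
qed

end
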